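(* Let $\omega$ be any root of unity, say a primitive $b$-th root of unity ($b\ge1$). Then there exist $q_N\in\operatorname{Spec}(\Theta)$, for $N$ along an infinite arithmetic progression, such that $q_N\to\omega$ and $|q_N|<1$. More precisely, for all sufficiently large $N$ in a suitable arithmetic progression, there are complex numbers $$\tau_N=\frac{\pi}{b}+O\left(\frac{\log N}{N}\right),\qquad v_N=\frac{3\pi}{4}+o(1)\qquad (N\to\infty),$$ such that, with $$q_N=\omega e^{-\tau_N/N},\qquad u_N=v_N/N,$$ one has $$H_N(q_N,u_N)=\partial_uH_N(q_N,u_N)=0 .$$ Consequently $x_N=-q_N^{-N}e^{u_N}$ is a multiple zero of $\Theta(q_N,\cdot)$.
   Context: Let $\mathbb D=\{q\in\mathbb C:|q|<1\}$. The partial theta function is $\Theta(q,x)=\sum_{j=0}^{\infty}q^{j(j+1)/2}x^j$ for $|q|<1$, $x\in\mathbb C$, and $$\operatorname{Spec}(\Theta)=\{q\in\mathbb D:\ \exists x\in\mathbb C\text{ such that }\Theta(q,x)=\partial_x\Theta(q,x)=0\}.$$ For an integer $N\ge1$, $|q|<1$ and $u\in\mathbb C$, $$H_N(q,u)=\sum_{s=-N}^{\infty}(-1)^s q^{s(s+1)/2}e^{su}.$$ *)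

theory Defs
  imports "HOL-Analysis.Analysis" "HOL-Library.Landau_Symbols"
begin

definition Theta :: "complex \<Rightarrow> complex \<Rightarrow> complex" where
  "Theta q x = (\<Sum>j. q ^ (j * (j + 1) div 2) * x ^ j)"

text \<open>
  A multiple zero of a function is a point where the function and its complex derivative both vanish.
  For partial derivatives, the remaining variables are held fixed.
\<close>

definition multiple_zero :: "(complex \<Rightarrow> complex) \<Rightarrow> complex \<Rightarrow> bool" where
  "multiple_zero f z \<longleftrightarrow> f z = 0 \<and> (f has_field_derivative 0) (at z)"

definition Spec_Theta :: "complex set" where
  "Spec_Theta = {q. norm q < 1 \<and> (\<exists>x. multiple_zero (Theta q) x)}"

text \<open>
  The exponent \<open>s (s + 1) / 2\<close> is a nonnegative integer for every integer \<open>s\<close>,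
  so neither \<open>div\<close> nor \<open>nat\<close> loses information here.
\<close>

definition H :: "nat \<Rightarrow> complex \<Rightarrow> complex \<Rightarrow> complex" where
  "H N q u = (\<Sum>\<^sub>\<infinity>s\<in>{- int N..}. (-1) powi s * q ^ nat (s * (s + 1) div 2) * exp (of_int s * u))"

definition primitive_root_of_unity :: "nat \<Rightarrow> complex \<Rightarrow> bool" where
  "primitive_root_of_unity b w \<longleftrightarrow> b \<ge> 1 \<and> w ^ b = 1 \<and> (\<forall>k. 0 < k \<and> k < b \<longrightarrow> w ^ k \<noteq> 1)"

definition arith_prog :: "nat \<Rightarrow> nat \<Rightarrow> nat set" where
  "arith_prog a d = {a + k * d |k. True}"

text \<open>The filter for \<open>N \<longrightarrow> \<infinity>\<close> with \<open>N\<close> restricted to the set \<open>S\<close>.\<close>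

definition sequentially_within :: "nat set \<Rightarrow> nat filter" where
  "sequentially_within S = inf sequentially (principal S)"

end

theory Submission
  imports Defs "HOL-Complex_Analysis.Complex_Analysis" "HOL-Probability.Distributions"
    "HOL-Real_Asymp.Real_Asymp"
begin

text \<open>
  Put \<open>q = \<omega> e\<^sup>-\<^sup>t\<close> with \<open>t = \<tau> / N\<close>, \<open>u = v / N\<close>, and let \<open>c\<^sub>s\<close> be \<open>(-1)\<^sup>s\<close> times \<open>\<omega>\<close> to the
  power \<open>s (s + 1) / 2\<close>. Then \<open>H N q u\<close> is the two-sided theta series
  \<open>\<Sum> c\<^sub>s exp (- t s (s + 1) / 2 + s u)\<close> over all integers minus its tail over \<open>s < - N\<close>. A
  double zero of \<open>H\<close> is a point where the theta series and the tail agree to first order, so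
  the two have to be of the same size.

  The coefficients satisfy \<open>c\<^bsub>s + b\<^esub> = - c\<^sub>s\<close>. In the inverted theta series the frequency zero
  is therefore missing, and the theta series is exponentially small. Its leading part comes
  from the two lowest frequencies, which combine into
  \<open>\<surd>N exp (- \<pi>\<^sup>2 N / (2 b\<^sup>2 \<tau>)) sin (\<pi> v / (b \<tau>))\<close> times a nonzero Gauss sum. The tail is
  carried by the indices near \<open>- N\<close>; it is asymptotic to \<open>exp (- \<tau> (N + 1) / 2) e\<^sup>-\<^sup>v\<close> times a
  constant that depends only on \<open>N\<close> modulo \<open>2 b\<close> and that is nonzero for a suitable residue
  class. The two exponential rates agree exactly for \<open>\<tau> = \<pi> / b\<close>, and the factor \<open>\<surd>N\<close> shifts
  \<open>\<tau>\<close> by \<open>- ln N / (2 N)\<close>. With \<open>\<tau> = \<pi> / b - ln N / (2 N) + (\<kappa> + w) / N\<close> and \<open>v\<close> replaced by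
  \<open>3 \<pi> / 4 + v\<close>, and with \<open>\<kappa>\<close> absorbing all constants, the theta series measured in units of
  the tail converges locally uniformly to \<open>e\<^bsup>w + v\<^esup> (cos v - sin v)\<close>; this is
  \<open>normalized_H_tendsto\<close>. The limit takes the value 1 with \<open>v\<close>-derivative 0 at \<open>w = v = 0\<close>; as
  a function of the unshifted variable \<open>v\<close> it is a multiple of \<open>e\<^sup>v sin v\<close>, and the
  logarithmic derivative \<open>cot v + 1\<close> vanishes at \<open>3 \<pi> / 4\<close>. This solution is nondegenerate,
  hence it survives small perturbations by Brouwer's fixed point theorem
  (\<open>double_points_near_model\<close>).

  The inversion formula (\<open>periodized_gauss_transformation\<close>) rests on the convergence of
  Fourier series of entire periodic functions (\<open>fourier_series_entire\<close>). The passage to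
  \<open>Theta\<close> is the identity \<open>Theta_eq_H\<close>: \<open>Theta q (- q\<^bsup>-N\<^esup> e\<^sup>z)\<close> is \<open>H N q z\<close> times a nowhere
  vanishing factor.
\<close>

section \<open>Gaussian series over the integers\<close>

text \<open>
  The exponent has \<open>s\<^sup>2 / 2\<close> in place of the triangular number \<open>s (s + 1) / 2\<close>; the
  latter is recovered by replacing \<open>z\<close> with \<open>z - t / 2\<close>. The index set is a parameter so that
  \<open>H\<close>, its tail and the two-sided theta series share one theory of convergence.
\<close>

definition gauss_series :: "(int \<Rightarrow> complex) \<Rightarrow> int set \<Rightarrow> complex \<Rightarrow> complex \<Rightarrow> complex" where
  "gauss_series d A t z = (\<Sum>\<^sub>\<infinity>s\<in>A. d s * exp (of_int s * z - t * (of_int s)\<^sup>2 / 2))"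

lemma summable_on_exp_neg_abs_int:
  fixes c :: real
  assumes "c > 0"
  shows "(\<lambda>s::int. exp (- c * \<bar>real_of_int s\<bar>)) summable_on A"
proof -
  have geo: "summable (\<lambda>n. exp (- c) ^ n)"
    using assms by (intro summable_geometric) auto
  have nat: "(\<lambda>n::nat. exp (- c * real n)) summable_on UNIV"
    using geo by (intro norm_summable_imp_summable_on)
      (simp add: mult.commute flip: exp_of_nat_mult)
  have "(\<lambda>s::int. exp (- c * \<bar>real_of_int s\<bar>)) summable_on {0..}"
  proof -
    have "bij_betw int UNIV {0..}"
      by (rule bij_betwI[where g = nat]) auto
    from summable_on_reindex_bij_betw[OF this, of "\<lambda>s::int. exp (- c * \<bar>real_of_int s\<bar>)"] nat
    show ?thesis by simp
  qed
  moreover have "(\<lambda>s::int. exp (- c * \<bar>real_of_int s\<bar>)) summable_on {..0}"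
  proof -
    have "bij_betw (\<lambda>n. - int n) UNIV {..0}"
      by (rule bij_betwI[where g = "\<lambda>s. nat (- s)"]) auto
    from summable_on_reindex_bij_betw[OF this, of "\<lambda>s::int. exp (- c * \<bar>real_of_int s\<bar>)"] nat
    show ?thesis by simp
  qed
  ultimately have "(\<lambda>s::int. exp (- c * \<bar>real_of_int s\<bar>)) summable_on ({0..} \<union> {..0})"
    by (rule summable_on_union)
  moreover have "{0..} \<union> {..0} = (UNIV :: int set)" by auto
  ultimately show ?thesis
    by (metis subset_UNIV summable_on_subset_banach)
qed

text \<open>
  Completing the square: any linear growth is absorbed by the quadratic decay, with enough left
  over for a geometric majorant.
\<close>

lemma gauss_majorant_le:
  fixes M e x :: real
  assumes "e > 0"
  shows "M * \<bar>x\<bar> - e * x\<^sup>2 / 2 \<le> (M + 1)\<^sup>2 / (2 * e) - \<bar>x\<bar>"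
proof -
  have "0 \<le> (e * \<bar>x\<bar> - (M + 1))\<^sup>2 / (2 * e)"
    using assms by simp
  also have "\<dots> = e * x\<^sup>2 / 2 - (M + 1) * \<bar>x\<bar> + (M + 1)\<^sup>2 / (2 * e)"
    using assms by (simp add: power2_eq_square field_simps)
  finally show ?thesis by (simp add: algebra_simps)
qed

lemma summable_on_gauss_majorant:
  fixes M e :: real
  assumes "e > 0"
  shows "(\<lambda>s::int. exp (M * \<bar>real_of_int s\<bar> - e * (real_of_int s)\<^sup>2 / 2)) summable_on A"
proof (rule summable_on_comparison_test)
  show "(\<lambda>s::int. exp ((M + 1)\<^sup>2 / (2 * e)) * exp (- 1 * \<bar>real_of_int s\<bar>)) summable_on A"
    by (intro summable_on_cmult_right summable_on_exp_neg_abs_int) simp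
  show "exp (M * \<bar>real_of_int s\<bar> - e * (real_of_int s)\<^sup>2 / 2)
      \<le> exp ((M + 1)\<^sup>2 / (2 * e)) * exp (- 1 * \<bar>real_of_int s\<bar>)" for s :: int
    using gauss_majorant_le[OF assms, of M "real_of_int s"] by (simp flip: exp_add)
qed auto

lemma norm_gauss_term_le:
  assumes "norm (d s) \<le> B" "e \<le> Re t" "\<bar>Re z\<bar> \<le> M"
  shows "norm (d s * exp (of_int s * z - t * (of_int s)\<^sup>2 / 2))
    \<le> B * exp (M * \<bar>real_of_int s\<bar> - e * (real_of_int s)\<^sup>2 / 2)"
proof -
  have "real_of_int s * Re z \<le> \<bar>real_of_int s\<bar> * \<bar>Re z\<bar>"
    by (metis abs_ge_self abs_mult)
  also have "\<dots> \<le> M * \<bar>real_of_int s\<bar>"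
    using assms(3) by (simp add: mult.commute mult_right_mono)
  finally have 1: "real_of_int s * Re z \<le> M * \<bar>real_of_int s\<bar>" .
  have 2: "e * (real_of_int s)\<^sup>2 \<le> Re t * (real_of_int s)\<^sup>2"
    using assms(2) by (intro mult_right_mono) auto
  have "Re (of_int s * z - t * (of_int s)\<^sup>2 / 2) = real_of_int s * Re z - Re t * (real_of_int s)\<^sup>2 / 2"
    by (simp flip: of_int_power)
  with 1 2 show ?thesis
    using assms(1) order.trans[OF norm_ge_zero assms(1)] unfolding norm_mult norm_exp_eq_Re
    by (intro mult_mono) auto
qed

lemma gauss_series_abs_summable:
  assumes "\<And>s. norm (d s) \<le> B" "Re t > 0"
  shows "(\<lambda>s. norm (d s * exp (of_int s * z - t * (of_int s)\<^sup>2 / 2))) summable_on A"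
proof (rule summable_on_comparison_test)
  show "(\<lambda>s. B * exp (\<bar>Re z\<bar> * \<bar>real_of_int s\<bar> - Re t * (real_of_int s)\<^sup>2 / 2)) summable_on A"
    using assms by (intro summable_on_cmult_right summable_on_gauss_majorant)
qed (auto intro: norm_gauss_term_le[OF assms(1)])

lemma gauss_series_summable:
  assumes "\<And>s. norm (d s) \<le> B" "Re t > 0"
  shows "(\<lambda>s. d s * exp (of_int s * z - t * (of_int s)\<^sup>2 / 2)) summable_on A"
  using gauss_series_abs_summable[OF assms] by (rule abs_summable_summable)

lemma gauss_series_uniform_limit:
  assumes "\<And>s. norm (d s) \<le> B" "e > 0"
  shows "uniform_limit {(t, z). e \<le> Re t \<and> \<bar>Re z\<bar> \<le> M}
     (\<lambda>X (t, z). \<Sum>s\<in>X. d s * exp (of_int s * z - t * (of_int s)\<^sup>2 / 2))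
     (\<lambda>(t, z). gauss_series d A t z) (finite_subsets_at_top A)"
proof -
  have "uniform_limit {(t, z). e \<le> Re t \<and> \<bar>Re z\<bar> \<le> M}
     (\<lambda>X p. \<Sum>s\<in>X. d s * exp (of_int s * snd p - fst p * (of_int s)\<^sup>2 / 2))
     (\<lambda>p. \<Sum>\<^sub>\<infinity>s\<in>A. d s * exp (of_int s * snd p - fst p * (of_int s)\<^sup>2 / 2)) (finite_subsets_at_top A)"
  proof (rule Weierstrass_m_test_general)
    show "(\<lambda>s. B * exp (M * \<bar>real_of_int s\<bar> - e * (real_of_int s)\<^sup>2 / 2)) summable_on A"
      using assms by (intro summable_on_cmult_right summable_on_gauss_majorant)
  qed (auto intro: norm_gauss_term_le[OF assms(1)])
  then show ?thesis
    by (simp add: gauss_series_def case_prod_unfold)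
qed

lemma continuous_on_gauss_series:
  assumes "\<And>s. norm (d s) \<le> B"
  shows "continuous_on {(t, z). Re t > 0} (\<lambda>(t, z). gauss_series d A t z)"
proof -
  have "continuous (at (t0, z0)) (\<lambda>(t, z). gauss_series d A t z)" if "Re t0 > 0" for t0 z0
  proof -
    define S where "S = {(t, z). Re t0 / 2 \<le> Re t \<and> \<bar>Re z\<bar> \<le> \<bar>Re z0\<bar> + 1}"
    define U where "U = {p. Re t0 / 2 < Re (fst p)} \<inter> {p. \<bar>Re (snd p)\<bar> < \<bar>Re z0\<bar> + 1}"
    have "continuous_on S (\<lambda>(t, z). gauss_series d A t z)"
      unfolding S_def
    proof (rule uniform_limit_theorem[OF _ gauss_series_uniform_limit])
      show "\<forall>\<^sub>F X in finite_subsets_at_top A. continuous_on {(t, z). Re t0 / 2 \<le> Re t \<and> \<bar>Re z\<bar> \<le> \<bar>Re z0\<bar> + 1}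
             (\<lambda>(t, z). \<Sum>s\<in>X. d s * exp (of_int s * z - t * (of_int s)\<^sup>2 / 2))"
        unfolding case_prod_unfold by (intro always_eventually allI continuous_intros) auto
    qed (use assms that in auto)
    moreover have "open U"
      unfolding U_def by (intro open_Int open_Collect_less continuous_intros)
    moreover have "U \<subseteq> S" "(t0, z0) \<in> U"
      using that by (auto simp: U_def S_def)
    ultimately show ?thesis
      by (meson continuous_on_eq_continuous_at continuous_on_subset)
  qed
  then show ?thesis
    by (intro continuous_at_imp_continuous_on) auto
qed

lemma gauss_series_holomorphic:
  assumes "\<And>s. norm (d s) \<le> B" "Re t > 0"
  shows "gauss_series d A t holomorphic_on UNIV"
proof -
  have "gauss_series d A t field_differentiable at z0" for z0
  proof -
    define f where "f = (\<lambda>X z. \<Sum>s\<in>X. d s * exp (of_int s * z - t * (of_int s)\<^sup>2 / 2))"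
    have "uniform_limit (cball z0 1) f (gauss_series d A t) (finite_subsets_at_top A)"
    proof -
      have "uniform_limit (cball z0 1)
          (\<lambda>X z. \<Sum>s\<in>X. d s * exp (of_int s * z - t * (of_int s)\<^sup>2 / 2))
          (\<lambda>z. \<Sum>\<^sub>\<infinity>s\<in>A. d s * exp (of_int s * z - t * (of_int s)\<^sup>2 / 2)) (finite_subsets_at_top A)"
      proof (rule Weierstrass_m_test_general)
        show "(\<lambda>s. B * exp ((\<bar>Re z0\<bar> + 1) * \<bar>real_of_int s\<bar> - Re t * (real_of_int s)\<^sup>2 / 2)) summable_on A"
          using assms by (intro summable_on_cmult_right summable_on_gauss_majorant)
        fix s z assume "z \<in> cball z0 (1::real)"
        then have "\<bar>Re (z0 - z)\<bar> \<le> 1"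
          using abs_Re_le_cmod[of "z0 - z"] by (simp add: dist_norm)
        then show "norm (d s * exp (of_int s * z - t * (of_int s)\<^sup>2 / 2))
          \<le> B * exp ((\<bar>Re z0\<bar> + 1) * \<bar>real_of_int s\<bar> - Re t * (real_of_int s)\<^sup>2 / 2)"
          by (intro norm_gauss_term_le[OF assms(1)]) auto
      qed
      then show ?thesis by (simp add: f_def gauss_series_def[abs_def])
    qed
    moreover have "f X holomorphic_on S" for X S
      unfolding f_def by (intro holomorphic_intros) auto
    ultimately obtain "gauss_series d A t holomorphic_on ball z0 1"
      by (rule_tac holomorphic_uniform_limit[where F = "finite_subsets_at_top A" and f = f and z = z0 and r = 1])
         (auto intro: always_eventually holomorphic_on_imp_continuous_on)
    then show ?thesis
      by (simp add: holomorphic_on_imp_differentiable_at)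
  qed
  then show ?thesis by (simp add: holomorphic_on_def field_differentiable_at_within)
qed

text \<open>
  On nonnegative indices the decay can also come from the linear term alone. This allows
  \<open>t = 0\<close>, the limiting value for the tail of \<open>H\<close>.
\<close>

lemma continuous_on_gauss_series_right:
  assumes "\<And>s. norm (d s) \<le> B" "A \<subseteq> {0..}" "p > 0"
  shows "continuous_on {(t, z). 0 \<le> Re t \<and> Re z \<le> - p} (\<lambda>(t, z). gauss_series d A t z)"
    (is "continuous_on ?S _")
proof -
  have "uniform_limit ?S
     (\<lambda>X q. \<Sum>s\<in>X. d s * exp (of_int s * snd q - fst q * (of_int s)\<^sup>2 / 2))
     (\<lambda>q. \<Sum>\<^sub>\<infinity>s\<in>A. d s * exp (of_int s * snd q - fst q * (of_int s)\<^sup>2 / 2)) (finite_subsets_at_top A)"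
  proof (rule Weierstrass_m_test_general)
    show "(\<lambda>s. B * exp (- p * \<bar>real_of_int s\<bar>)) summable_on A"
      using assms by (intro summable_on_cmult_right summable_on_exp_neg_abs_int)
    fix s q assume "s \<in> A" "q \<in> ?S"
    then have "real_of_int s \<ge> 0" "Re (fst q) \<ge> 0" "Re (snd q) \<le> - p"
      using assms(2) by auto
    moreover from this have "real_of_int s * Re (snd q) \<le> real_of_int s * (- p)"
      by (intro mult_left_mono) auto
    moreover have "real_of_int s * (- p) = - p * \<bar>real_of_int s\<bar>" if "real_of_int s \<ge> 0"
      using that by simp
    moreover have "Re (fst q) * (real_of_int s)\<^sup>2 \<ge> 0" if "Re (fst q) \<ge> 0"
      using that by simp
    ultimately have "real_of_int s * Re (snd q) - Re (fst q) * (real_of_int s)\<^sup>2 / 2 \<le> - p * \<bar>real_of_int s\<bar>"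
      by linarith
    moreover have "Re (of_int s * snd q - fst q * (of_int s)\<^sup>2 / 2)
        = real_of_int s * Re (snd q) - Re (fst q) * (real_of_int s)\<^sup>2 / 2"
      by (simp flip: of_int_power)
    ultimately show "norm (d s * exp (of_int s * snd q - fst q * (of_int s)\<^sup>2 / 2))
        \<le> B * exp (- p * \<bar>real_of_int s\<bar>)"
      using assms(1)[of s] order.trans[OF norm_ge_zero assms(1)] unfolding norm_mult norm_exp_eq_Re
      by (intro mult_mono) auto
  qed
  then have "continuous_on ?S (\<lambda>q. \<Sum>\<^sub>\<infinity>s\<in>A. d s * exp (of_int s * snd q - fst q * (of_int s)\<^sup>2 / 2))"
    by (rule uniform_limit_theorem[rotated])
      (auto intro!: always_eventually continuous_intros)
  then show ?thesis
    by (simp add: gauss_series_def case_prod_unfold)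
qed

section \<open>Fourier series of entire periodic functions\<close>

text \<open>
  If \<open>P\<close> is a primitive of \<open>\<phi>\<close>, the integral over the shifted period is \<open>P (s + 1) - P s\<close>, whose
  derivative in \<open>s\<close> vanishes by periodicity. This replaces moving a contour, and it holds for
  complex \<open>s\<close>.
\<close>

lemma integral_periodic_shift:
  assumes hol: "\<phi> holomorphic_on UNIV" and per: "\<And>z. \<phi> (z + 1) = \<phi> z"
  shows "integral {0..1} (\<lambda>x. \<phi> (of_real x + s)) = integral {0..1} (\<lambda>x. \<phi> (of_real x))"
proof -
  obtain P where "\<And>z. (P has_field_derivative \<phi> z) (at z within UNIV)"
    using holomorphic_convex_primitive'[OF convex_UNIV open_UNIV hol] by auto
  then have P: "(P has_field_derivative \<phi> z) (at z)" for z by simp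
  have int: "integral {0..1} (\<lambda>x. \<phi> (of_real x + s)) = P (s + 1) - P s" for s
  proof -
    have "((\<lambda>x. \<phi> (of_real x + s)) has_integral P (of_real 1 + s) - P (of_real 0 + s)) {0..1}"
    proof (rule fundamental_theorem_of_calculus)
      fix x :: real
      have "((\<lambda>z. P (z + s)) has_field_derivative \<phi> (of_real x + s)) (at (of_real x))"
        using P DERIV_shift[of P "\<phi> (of_real x + s)" "of_real x" s] by simp
      then show "((\<lambda>x. P (of_real x + s)) has_vector_derivative \<phi> (of_real x + s)) (at x within {0..1})"
        using has_vector_derivative_real_field has_vector_derivative_at_within by blast
    qed simp
    then show ?thesis by (simp add: integral_unique add.commute)
  qed
  have "((\<lambda>z. P (z + 1) - P z) has_field_derivative 0) (at z)" for z
    using DERIV_diff[OF DERIV_shift[THEN iffD1, OF P[of "z + 1"]] P[of z]] per by simp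
  then obtain c where "\<And>z. P (z + 1) - P z = c"
    using has_field_derivative_zero_constant[OF convex_UNIV, of "\<lambda>z. P (z + 1) - P z"] by auto
  then have "P (s + 1) - P s = P (0 + 1) - P 0" by metis
  with int[of s] int[of 0] show ?thesis by simp
qed

definition fourier_coeff :: "(complex \<Rightarrow> complex) \<Rightarrow> int \<Rightarrow> complex" where
  "fourier_coeff f k = integral {0..1} (\<lambda>x. f (of_real x) * exp (- (2 * pi * \<i> * of_int k * of_real x)))"

lemma exp_2pi_int_shift: "exp (- (2 * pi * \<i> * of_int k * (z + 1))) = exp (- (2 * pi * \<i> * of_int k * z))"
proof -
  have "- (2 * pi * \<i> * of_int k * (z + 1)) = - (2 * pi * \<i> * of_int k * z) + \<i> * (of_int (- k) * (of_real pi * 2))"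
    by (simp add: algebra_simps)
  then show ?thesis
    by (metis exp_plus_2pin[of "- (2 * pi * \<i> * of_int k * z)" "- k"])
qed

lemma fourier_coeff_shift:
  assumes hol: "f holomorphic_on UNIV" and per: "\<And>z. f (z + 1) = f z"
  shows "fourier_coeff f k = integral {0..1} (\<lambda>x. f (of_real x + s) * exp (- (2 * pi * \<i> * of_int k * (of_real x + s))))"
  unfolding fourier_coeff_def
  by (rule integral_periodic_shift[symmetric, where \<phi> = "\<lambda>z. f z * exp (- (2 * pi * \<i> * of_int k * z))"])
     (auto intro!: holomorphic_intros hol simp only: per exp_2pi_int_shift)

lemma fourier_coeff_translate:
  assumes hol: "f holomorphic_on UNIV" and per: "\<And>z. f (z + 1) = f z"
  shows "fourier_coeff (\<lambda>z. f (z + w)) k = fourier_coeff f k * exp (2 * pi * \<i> * of_int k * w)"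
proof -
  have "fourier_coeff f k * exp (2 * pi * \<i> * of_int k * w) =
    integral {0..1} (\<lambda>x. f (of_real x + w) * exp (- (2 * pi * \<i> * of_int k * (of_real x + w))) * exp (2 * pi * \<i> * of_int k * w))"
    by (simp add: fourier_coeff_shift[OF assms, of k w])
  also have "\<dots> = fourier_coeff (\<lambda>z. f (z + w)) k"
    unfolding fourier_coeff_def by (simp add: mult.assoc flip: exp_add) (simp add: algebra_simps)
  finally show ?thesis ..
qed

text \<open>
  Moving the path of integration to height \<open>1\<close> or \<open>-1\<close>, according to the sign of \<open>k\<close>, gains the
  exponential factor.
\<close>

lemma norm_fourier_coeff_le:
  assumes hol: "f holomorphic_on UNIV" and per: "\<And>z. f (z + 1) = f z"
  obtains M where "\<And>k. norm (fourier_coeff f k) \<le> M * exp (- (2 * pi * \<bar>of_int k\<bar>))"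
proof -
  define S where "S = (\<lambda>x. of_real x + \<i>) ` {0..1} \<union> (\<lambda>x. of_real x - \<i>) ` {0..1::real}"
  have "compact (f ` S)"
    unfolding S_def
    by (intro compact_continuous_image continuous_on_subset[OF holomorphic_on_imp_continuous_on[OF hol]]
        compact_Un continuous_intros) auto
  then obtain M where M: "\<And>z. z \<in> S \<Longrightarrow> norm (f z) \<le> M"
    by (metis bounded_iff compact_imp_bounded image_eqI)
  have "norm (fourier_coeff f k) \<le> M * exp (- (2 * pi * \<bar>of_int k\<bar>))" for k
  proof -
    define s where "s = (if k \<ge> 0 then - \<i> else \<i>)"
    define g where "g = (\<lambda>x::real. f (of_real x + s) * exp (- (2 * pi * \<i> * of_int k * (of_real x + s))))"
    have cont: "continuous_on {0..1} g"
      unfolding g_def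
      by (intro continuous_intros continuous_on_compose2[OF holomorphic_on_imp_continuous_on[OF hol]]) auto
    have "norm (g x) \<le> M * exp (- (2 * pi * \<bar>of_int k\<bar>))" if "x \<in> {0..1}" for x
    proof -
      have "norm (f (of_real x + s)) \<le> M"
        using that by (intro M) (auto simp: S_def s_def)
      moreover have "Re (- (2 * pi * \<i> * of_int k * (of_real x + s))) = - (2 * pi * \<bar>of_int k\<bar>)"
        by (auto simp: s_def)
      ultimately show ?thesis
        unfolding g_def norm_mult norm_exp_eq_Re by (simp only: mult_right_mono exp_ge_zero)
    qed
    with cont have "norm (integral {0..1} g) \<le> M * exp (- (2 * pi * \<bar>of_int k\<bar>)) * (1 - 0)"
      by (intro integral_bound) auto
    then show ?thesis
      using fourier_coeff_shift[OF assms, of k s] by (simp add: g_def)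
  qed
  then show ?thesis by (rule that)
qed

lemma fourier_coeff_integrable:
  assumes "f holomorphic_on UNIV"
  shows "(\<lambda>x::real. f (of_real x) * exp (- (2 * pi * \<i> * of_int k * of_real x))) integrable_on {0..1}"
  by (intro integrable_continuous_real continuous_intros
      continuous_on_compose2[OF holomorphic_on_imp_continuous_on[OF assms]]) auto

lemma integral_exp_int:
  "integral {0..1} (\<lambda>x::real. exp (- (2 * pi * \<i> * of_int k * of_real x))) = (if k = 0 then 1 else 0)"
proof (cases "k = 0")
  case False
  define c where "c = - (2 * pi * \<i> * of_int k)"
  have c: "c \<noteq> 0" using False by (simp add: c_def)
  have "((\<lambda>x::real. exp (c * of_real x)) has_integral exp (c * of_real 1) / c - exp (c * of_real 0) / c) {0..1}"
  proof (rule fundamental_theorem_of_calculus)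
    fix x :: real
    have "((\<lambda>z. exp (c * z) / c) has_field_derivative exp (c * of_real x)) (at (of_real x))"
      using c by (auto intro!: derivative_eq_intros)
    then show "((\<lambda>x. exp (c * of_real x) / c) has_vector_derivative exp (c * of_real x)) (at x within {0..1})"
      using has_vector_derivative_real_field has_vector_derivative_at_within by blast
  qed simp
  moreover have "exp (c * of_real 1) = 1"
    using exp_2pi_int_shift[of k 0] by (simp add: c_def)
  ultimately show ?thesis using False by (simp add: integral_unique c_def)
qed simp

lemma periodic_of_int:
  fixes f :: "complex \<Rightarrow> 'a"
  assumes per: "\<And>z. f (z + 1) = f z"
  shows "f (z + of_int n) = f z"
proof (induction n rule: int_induct[where k = 0])
  case (step1 i)
  then show ?case using per[of "z + of_int i"] by (simp add: add_ac)
next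
  case (step2 i)
  then show ?case using per[of "z + of_int i - 1"] by (simp add: algebra_simps)
qed simp

text \<open>
  The zeros of \<open>exp (2 \<pi> \<i> z) - 1\<close> are simple and are exactly the integers, where \<open>f - f 0\<close>
  vanishes by periodicity. All singularities of the quotient are therefore removable.
\<close>

lemma entire_difference_quotient:
  assumes hol: "f holomorphic_on UNIV" and per: "\<And>z. f (z + 1) = f z"
  obtains h where "h holomorphic_on UNIV" "\<And>z. h (z + 1) = h z"
    "\<And>z. f z - f 0 = h z * (exp (2 * pi * \<i> * z) - 1)"
proof -
  define e where "e = (\<lambda>z. exp (2 * pi * \<i> * z) - 1)"
  have e0: "e z = 0 \<longleftrightarrow> z \<in> \<int>" for z
  proof
    assume "e z = 0"
    then have "exp (2 * pi * \<i> * z) = exp 0"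
      by (simp add: e_def)
    then obtain n :: int where "2 * pi * \<i> * z = 0 + (of_int (2 * n) * pi) * \<i>"
      unfolding exp_eq by blast
    then have "z = of_int n" by simp
    then show "z \<in> \<int>" by simp
  next
    assume "z \<in> \<int>"
    then obtain n where "z = of_int n" by (auto elim: Ints_cases)
    then show "e z = 0" using exp_2pi_int_shift[of "-n" 0] by (simp add: e_def mult_ac)
  qed
  have fint: "f (z + of_int n) = f z" for z n
    using per by (rule periodic_of_int)
  have eper: "e (z + 1) = e z" for z using exp_2pi_int_shift[of "-1" z] by (simp add: e_def)
  define h where "h = (\<lambda>z. if z \<in> \<int> then deriv f 0 / (2 * pi * \<i>) else (f z - f 0) / e z)"
  have ehol: "e holomorphic_on S" for S unfolding e_def by (intro holomorphic_intros)
  have hper: "h (z + 1) = h z" for z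
  proof -
    have "z + 1 \<in> \<int> \<longleftrightarrow> z \<in> \<int>" by (metis Ints_1 Ints_add Ints_diff add_diff_cancel)
    then show ?thesis by (simp add: h_def per eper)
  qed
  have hint: "h (z + of_int n) = h z" for z n
    using hper by (rule periodic_of_int)
  have clos: "open (- \<int> :: complex set)" using closed_Ints by auto
  have off: "h holomorphic_on - \<int>"
  proof -
    have "(\<lambda>z. (f z - f 0) / e z) holomorphic_on - \<int>"
      using hol by (intro holomorphic_intros ehol holomorphic_on_subset[OF hol]) (auto simp: e0)
    then show ?thesis by (rule holomorphic_transform) (auto simp: h_def)
  qed
\<comment> \<open>By periodicity the integers reduce to the single singularity at 0.\<close>
  have near0: "h holomorphic_on ball 0 1"
  proof (rule no_isolated_singularity'[where K = "{0}"])
    have ball: "z \<notin> \<int>" if "z \<in> ball 0 1 - {0}" for z :: complex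
      using that by (auto elim!: Ints_cases simp: norm_of_int simp flip: of_int_abs)
    then show "h holomorphic_on ball 0 1 - {0}"
      by (intro holomorphic_on_subset[OF off]) auto
    fix z :: complex assume "z \<in> {0}"
    then have z: "z = 0" by simp
    have f': "((\<lambda>z. (f z - f 0) / z) \<longlongrightarrow> deriv f 0) (at 0)"
      using holomorphic_derivI[OF hol open_UNIV, of 0] by (simp add: has_field_derivative_iff)
    have e': "((\<lambda>z. e z / z) \<longlongrightarrow> 2 * pi * \<i>) (at 0)"
    proof -
      have "(e has_field_derivative 2 * pi * \<i>) (at 0)"
        unfolding e_def by (auto intro!: derivative_eq_intros)
      then show ?thesis by (simp add: has_field_derivative_iff e_def)
    qed
    have "((\<lambda>z. ((f z - f 0) / z) / (e z / z)) \<longlongrightarrow> deriv f 0 / (2 * pi * \<i>)) (at 0)"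
      by (intro tendsto_divide f' e') simp
    moreover have "\<forall>\<^sub>F z in at 0. ((f z - f 0) / z) / (e z / z) = h z"
    proof -
      have "\<forall>\<^sub>F z in at (0::complex). z \<in> ball 0 1 - {0}"
        by (intro eventually_at_in_open) auto
      then show ?thesis
        by (rule eventually_mono) (use ball in \<open>auto simp: h_def\<close>)
    qed
    ultimately have "(h \<longlongrightarrow> h 0) (at 0)"
      by (simp add: tendsto_cong h_def)
    then show "(h \<longlongrightarrow> h z) (at z within ball 0 1)"
      using z tendsto_within_subset by blast
  qed auto
  have "h field_differentiable at z" for z
  proof (cases "z \<in> \<int>")
    case False
    then show ?thesis using off clos by (simp add: holomorphic_on_imp_differentiable_at)
  next
    case True
    then obtain n where n: "z = of_int n" by (auto elim: Ints_cases)
    obtain D where "(h has_field_derivative D) (at 0)"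
      using near0 holomorphic_on_imp_differentiable_at[OF near0 open_ball, of 0]
      by (auto simp: field_differentiable_def)
    then have "((\<lambda>w. h (w + of_int (- n))) has_field_derivative D) (at z)"
      using DERIV_shift[of h D z "of_int (- n)"] n by simp
    then show ?thesis unfolding hint field_differentiable_def by blast
  qed
  then have "h holomorphic_on UNIV"
    by (simp add: holomorphic_on_def field_differentiable_at_within)
  moreover have "f z - f 0 = h z * (exp (2 * pi * \<i> * z) - 1)" for z
  proof (cases "z \<in> \<int>")
    case True
    then obtain n where "z = of_int n" by (auto elim: Ints_cases)
    then have "f z = f 0" using fint[of 0 n] by simp
    then show ?thesis using e0[of z] True by (simp add: e_def)
  next
    case False
    then show ?thesis using e0[of z] by (simp add: h_def e_def)
  qed
  ultimately show ?thesis using hper that by blast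
qed

lemma sum_int_telescope:
  fixes g :: "int \<Rightarrow> complex"
  shows "(\<Sum>k\<in>{- int n..int n}. g (k - 1) - g k) = g (- int n - 1) - g (int n)"
proof (induction n)
  case (Suc n)
  have set: "{- int (Suc n)..int (Suc n)} = insert (- int (Suc n)) (insert (int (Suc n)) {- int n..int n})"
    by auto
  have "(\<Sum>k\<in>{- int (Suc n)..int (Suc n)}. g (k - 1) - g k) =
      (g (- int (Suc n) - 1) - g (- int (Suc n))) + ((g (int (Suc n) - 1) - g (int (Suc n)))
      + (\<Sum>k\<in>{- int n..int n}. g (k - 1) - g k))"
    unfolding set by (subst sum.insert; simp)+
  moreover have "- int (Suc n) = - int n - 1" "int (Suc n) - 1 = int n" by auto
  ultimately show ?case using Suc.IH by (simp only:) simp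
qed simp

text \<open>
  After a translation it suffices to evaluate at \<open>0\<close>. Writing \<open>g - g 0\<close> as \<open>(exp (2 \<pi> \<i> z) - 1) h\<close>
  turns the coefficients of \<open>g\<close> into differences of consecutive coefficients of \<open>h\<close>, up to
  the term \<open>g 0\<close> at \<open>k = 0\<close>. The symmetric partial sums telescope, and the two end terms
  decay exponentially.
\<close>

theorem fourier_series_entire:
  assumes hol: "f holomorphic_on UNIV" and per: "\<And>z. f (z + 1) = f z"
  shows "(\<lambda>n. \<Sum>k\<in>{- int n..int n}. fourier_coeff f k * exp (2 * pi * \<i> * of_int k * w)) \<longlonglongrightarrow> f w"
proof -
  define g where "g = (\<lambda>z. f (z + w))"
  have ghol: "g holomorphic_on UNIV"
    unfolding g_def using holomorphic_on_compose_gen[OF _ hol, of "\<lambda>z. z + w" UNIV]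
    by (simp add: o_def holomorphic_intros)
  have gper: "g (z + 1) = g z" for z using per[of "z + w"] by (simp add: g_def add_ac)
  obtain h where h: "h holomorphic_on UNIV" "\<And>z. h (z + 1) = h z"
    "\<And>z. g z - g 0 = h z * (exp (2 * pi * \<i> * z) - 1)"
    using entire_difference_quotient[OF ghol gper] by blast
  have coeff: "fourier_coeff g k = (if k = 0 then g 0 else 0) + (fourier_coeff h (k - 1) - fourier_coeff h k)" for k
  proof -
    let ?e = "\<lambda>k x. exp (- (2 * pi * \<i> * of_int k * of_real x))"
    have "fourier_coeff g k = integral {0..1} (\<lambda>x. g 0 * ?e k x + (h (of_real x) * ?e (k - 1) x - h (of_real x) * ?e k x))"
      unfolding fourier_coeff_def[of g]
    proof (rule integral_cong)
      fix x :: real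
      have "?e (k - 1) x = exp (2 * pi * \<i> * of_real x) * ?e k x"
        by (simp add: algebra_simps flip: exp_add)
      moreover have "g (of_real x) = g 0 + h (of_real x) * (exp (2 * pi * \<i> * of_real x) - 1)"
        using h(3)[of "of_real x"] by (simp add: algebra_simps)
      ultimately show "g (of_real x) * ?e k x = g 0 * ?e k x + (h (of_real x) * ?e (k - 1) x - h (of_real x) * ?e k x)"
        by (simp only: distrib_right distrib_left right_diff_distrib left_diff_distrib mult_1 mult_1_right mult.assoc)
    qed
    also have "\<dots> = integral {0..1} (\<lambda>x. g 0 * ?e k x) + (fourier_coeff h (k - 1) - fourier_coeff h k)"
      unfolding fourier_coeff_def
      by (intro trans[OF integral_add] arg_cong2[where f = "(+)"] integral_diff refl integrable_diff
          fourier_coeff_integrable h(1) fourier_coeff_integrable[of "\<lambda>_. g 0"] holomorphic_intros)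
    also have "integral {0..1} (\<lambda>x. g 0 * ?e k x) = (if k = 0 then g 0 else 0)"
      using integral_exp_int[of k] by simp
    finally show ?thesis .
  qed
  have partial: "(\<Sum>k\<in>{- int n..int n}. fourier_coeff g k) = g 0 + (fourier_coeff h (- int n - 1) - fourier_coeff h (int n))" for n
    unfolding coeff sum.distrib sum_int_telescope by simp
  obtain M where M: "\<And>k. norm (fourier_coeff h k) \<le> M * exp (- (2 * pi * \<bar>of_int k\<bar>))"
    using norm_fourier_coeff_le[OF h(1,2)] by blast
  have lim: "(\<lambda>n. M * exp (- (2 * pi * real n))) \<longlonglongrightarrow> 0"
    by (intro tendsto_mult_right_zero filterlim_compose[OF exp_at_bot] filterlim_compose[OF filterlim_uminus_at_bot_at_top]
        filterlim_tendsto_pos_mult_at_top[OF tendsto_const] filterlim_real_sequentially) auto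
  have c1: "(\<lambda>n. fourier_coeff h (int n)) \<longlonglongrightarrow> 0"
    by (rule Lim_null_comparison[OF always_eventually lim]) (use M[of "int _"] in auto)
  have c2: "(\<lambda>n. fourier_coeff h (- int n - 1)) \<longlonglongrightarrow> 0"
  proof (rule Lim_null_comparison[OF always_eventually LIMSEQ_Suc[OF lim]], rule allI)
    show "norm (fourier_coeff h (- int n - 1)) \<le> M * exp (- (2 * pi * real (Suc n)))" for n
      using M[of "- int n - 1"] by (simp add: algebra_simps)
  qed
  have "(\<lambda>n. g 0 + (fourier_coeff h (- int n - 1) - fourier_coeff h (int n))) \<longlonglongrightarrow> g 0 + (0 - 0)"
    by (intro tendsto_intros c1 c2)
  then show ?thesis
    unfolding partial[symmetric] by (simp add: g_def fourier_coeff_translate[OF hol per, of w])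
qed

section \<open>Inversion of the Gaussian theta series\<close>

lemma filterlim_symmetric_int_intervals:
  "filterlim (\<lambda>n. {- int n..int n}) (finite_subsets_at_top UNIV) sequentially"
  unfolding filterlim_finite_subsets_at_top
proof (intro allI impI)
  fix X :: "int set" assume "finite X \<and> X \<subseteq> UNIV"
  then obtain B where B: "\<And>x. x \<in> X \<Longrightarrow> \<bar>x\<bar> \<le> B"
    by (metis Max_ge finite_imageI imageI)
  have "X \<subseteq> {- int n..int n}" if "n \<ge> nat B" for n
  proof
    fix x assume "x \<in> X"
    then have "\<bar>x\<bar> \<le> int n" using B[of x] that by linarith
    then show "x \<in> {- int n..int n}" by auto
  qed
  then show "\<forall>\<^sub>F n in sequentially. finite {- int n..int n} \<and> X \<subseteq> {- int n..int n} \<and> {- int n..int n} \<subseteq> UNIV"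
    unfolding eventually_sequentially by (intro exI[of _ "nat B"]) simp
qed

definition periodized_gauss :: "complex \<Rightarrow> complex \<Rightarrow> complex" where
  "periodized_gauss t y = (\<Sum>\<^sub>\<infinity>m::int. exp (- (t * (y - of_int m)\<^sup>2 / 2)))"

lemma periodized_gauss_eq:
  "periodized_gauss t y = exp (- (t * y\<^sup>2 / 2)) * gauss_series (\<lambda>_. 1) UNIV t (t * y)"
proof -
  have "exp (- (t * (y - of_int m)\<^sup>2 / 2)) =
      exp (- (t * y\<^sup>2 / 2)) * (1 * exp (of_int m * (t * y) - t * (of_int m)\<^sup>2 / 2))" for m :: int
  proof -
    have "- (t * (y - of_int m)\<^sup>2 / 2) = - (t * y\<^sup>2 / 2) + (of_int m * (t * y) - t * (of_int m)\<^sup>2 / 2)"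
      by (simp add: power2_eq_square field_simps)
    then show ?thesis by (simp only: exp_add mult_1)
  qed
  then show ?thesis
    unfolding periodized_gauss_def gauss_series_def by (simp only: infsum_cmult_right')
qed

lemma periodized_gauss_holomorphic:
  fixes t :: complex
  assumes "Re t > 0"
  shows "periodized_gauss t holomorphic_on UNIV"
proof -
  have "(\<lambda>y. gauss_series (\<lambda>_. 1) UNIV t (t * y)) holomorphic_on UNIV"
    by (rule holomorphic_on_compose_gen[OF _ gauss_series_holomorphic[of "\<lambda>_. 1" 1], unfolded o_def])
       (use assms in \<open>auto intro!: holomorphic_intros\<close>)
  then show ?thesis
    unfolding periodized_gauss_eq[abs_def] by (intro holomorphic_intros) auto
qed

lemma periodized_gauss_periodic: "periodized_gauss t (y + 1) = periodized_gauss t y"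
proof -
  have "bij (\<lambda>m::int. m + 1)"
    by (rule bijI') (auto intro: exI[of _ "_ - 1"])
  from infsum_reindex_bij_betw[OF this, of "\<lambda>m. exp (- (t * (y + 1 - of_int m)\<^sup>2 / 2))"]
  show ?thesis by (simp add: periodized_gauss_def)
qed

text \<open>
  The imaginary quasi-period \<open>2 \<pi> \<i> / t\<close> is what determines the Fourier coefficients: it links
  the coefficient of index \<open>k\<close> to that of index \<open>k + 1\<close>.
\<close>

lemma periodized_gauss_quasi_periodic:
  fixes t :: complex
  assumes "t \<noteq> 0"
  shows "periodized_gauss t (y + 2 * pi * \<i> / t)
    = exp (2 * pi\<^sup>2 / t - 2 * pi * \<i> * y) * periodized_gauss t y"
proof -
  have "exp (- (t * (y + 2 * pi * \<i> / t - of_int m)\<^sup>2 / 2)) =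
      exp (2 * pi\<^sup>2 / t - 2 * pi * \<i> * y) * exp (- (t * (y - of_int m)\<^sup>2 / 2))" for m :: int
  proof -
    have "- (t * (y + 2 * pi * \<i> / t - of_int m)\<^sup>2 / 2) =
      (2 * pi\<^sup>2 / t - 2 * pi * \<i> * y - t * (y - of_int m)\<^sup>2 / 2) + \<i> * (of_int m * (of_real pi * 2))"
      using assms by (simp add: power2_eq_square field_simps)
    then show ?thesis by (simp add: exp_plus_2pin flip: exp_add)
  qed
  then show ?thesis
    unfolding periodized_gauss_def by (simp add: infsum_cmult_right')
qed

lemma periodized_gauss_fourier_coeff:
  fixes t :: complex
  assumes "Re t > 0"
  shows "fourier_coeff (periodized_gauss t) k
    = fourier_coeff (periodized_gauss t) 0 * exp (- (2 * pi\<^sup>2 * (of_int k)\<^sup>2 / t))"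
proof -
  have t: "t \<noteq> 0" using assms by auto
  have step: "fourier_coeff (periodized_gauss t) k = exp (2 * pi\<^sup>2 * (2 * of_int k + 1) / t)
      * fourier_coeff (periodized_gauss t) (k + 1)" for k
  proof -
    define s where "s = 2 * pi * \<i> / t"
    have "periodized_gauss t (x + s) * exp (- (2 * pi * \<i> * of_int k * (x + s))) =
      exp (2 * pi\<^sup>2 * (2 * of_int k + 1) / t) * (periodized_gauss t x * exp (- (2 * pi * \<i> * of_int (k + 1) * x)))" for x :: complex
    proof -
      have "exp (2 * pi\<^sup>2 / t - 2 * pi * \<i> * x) * exp (- (2 * pi * \<i> * of_int k * (x + s))) =
        exp (2 * pi\<^sup>2 * (2 * of_int k + 1) / t) * exp (- (2 * pi * \<i> * of_int (k + 1) * x))"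
        unfolding exp_add[symmetric]
        using t by (intro arg_cong[of _ _ exp]) (simp add: s_def power2_eq_square field_simps)
      then show ?thesis
        using periodized_gauss_quasi_periodic[OF t, of x] by (simp add: s_def mult_ac)
    qed
    then show ?thesis
      using fourier_coeff_shift[OF periodized_gauss_holomorphic[OF assms] periodized_gauss_periodic, of k s]
      by (simp add: fourier_coeff_def)
  qed
  show ?thesis
  proof (induction k rule: int_induct[where k = 0])
    case (step1 i)
    have "exp (2 * pi\<^sup>2 * (2 * of_int i + 1) / t) * exp (- (2 * pi\<^sup>2 * (of_int (i + 1))\<^sup>2 / t)) = exp (- (2 * pi\<^sup>2 * (of_int i)\<^sup>2 / t))"
      unfolding exp_add[symmetric]
      using t by (intro arg_cong[of _ _ exp]) (simp add: power2_eq_square field_simps)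
    with step[of i] step1(2) have "exp (2 * pi\<^sup>2 * (2 * of_int i + 1) / t) * fourier_coeff (periodized_gauss t) (i + 1)
        = exp (2 * pi\<^sup>2 * (2 * of_int i + 1) / t)
          * (fourier_coeff (periodized_gauss t) 0 * exp (- (2 * pi\<^sup>2 * (of_int (i + 1))\<^sup>2 / t)))"
      by (simp only: mult.left_commute)
    then show ?case by (simp only: mult_left_cancel[OF exp_not_eq_zero])
  next
    case (step2 i)
    have "exp (2 * pi\<^sup>2 * (2 * of_int (i - 1) + 1) / t) * exp (- (2 * pi\<^sup>2 * (of_int i)\<^sup>2 / t)) = exp (- (2 * pi\<^sup>2 * (of_int (i - 1))\<^sup>2 / t))"
      unfolding exp_add[symmetric]
      using t by (intro arg_cong[of _ _ exp]) (simp add: power2_eq_square field_simps)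
    with step[of "i - 1"] step2(2) show ?case
      by (simp add: mult_ac)
  qed simp
qed

text \<open>
  Jacobi's inversion formula, for complex \<open>t\<close> and \<open>w\<close>: the right-hand side is the Fourier
  series of the left-hand side.
\<close>

theorem periodized_gauss_transformation:
  fixes t :: complex
  assumes "Re t > 0"
  shows "periodized_gauss t w = fourier_coeff (periodized_gauss t) 0
    * gauss_series (\<lambda>_. 1) UNIV (4 * pi\<^sup>2 / t) (2 * pi * \<i> * w)"
proof -
  let ?C = "fourier_coeff (periodized_gauss t) 0"
  have re: "Re (4 * pi\<^sup>2 / t) > 0"
    using assms by (auto simp: Re_divide zero_less_divide_iff sum_power2_gt_zero_iff simp flip: of_real_power)
  have "((\<lambda>k. 1 * exp (of_int k * (2 * pi * \<i> * w) - 4 * pi\<^sup>2 / t * (of_int k)\<^sup>2 / 2)) has_sum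
      gauss_series (\<lambda>_. 1) UNIV (4 * pi\<^sup>2 / t) (2 * pi * \<i> * w)) UNIV"
    unfolding gauss_series_def by (intro has_sum_infsum gauss_series_summable[of _ 1] re) simp
  then have "((\<lambda>n. \<Sum>k\<in>{- int n..int n}. 1 * exp (of_int k * (2 * pi * \<i> * w) - 4 * pi\<^sup>2 / t * (of_int k)\<^sup>2 / 2))
     \<longlongrightarrow> gauss_series (\<lambda>_. 1) UNIV (4 * pi\<^sup>2 / t) (2 * pi * \<i> * w)) sequentially"
    unfolding has_sum_def by (rule filterlim_compose[OF _ filterlim_symmetric_int_intervals])
  then have "(\<lambda>n. ?C * (\<Sum>k\<in>{- int n..int n}. 1 * exp (of_int k * (2 * pi * \<i> * w) - 4 * pi\<^sup>2 / t * (of_int k)\<^sup>2 / 2)))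
     \<longlonglongrightarrow> ?C * gauss_series (\<lambda>_. 1) UNIV (4 * pi\<^sup>2 / t) (2 * pi * \<i> * w)"
    by (rule tendsto_mult_left)
  moreover have "?C * (\<Sum>k\<in>{- int n..int n}. 1 * exp (of_int k * (2 * pi * \<i> * w) - 4 * pi\<^sup>2 / t * (of_int k)\<^sup>2 / 2))
      = (\<Sum>k\<in>{- int n..int n}. fourier_coeff (periodized_gauss t) k * exp (2 * pi * \<i> * of_int k * w))" for n
    unfolding sum_distrib_left
  proof (rule sum.cong[OF refl])
    fix k
    have "exp (of_int k * (2 * pi * \<i> * w) - 4 * pi\<^sup>2 / t * (of_int k)\<^sup>2 / 2)
        = exp (- (2 * pi\<^sup>2 * (of_int k)\<^sup>2 / t)) * exp (2 * pi * \<i> * of_int k * w)"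
      by (simp add: mult_ac flip: exp_add)
    then show "?C * (1 * exp (of_int k * (2 * pi * \<i> * w) - 4 * pi\<^sup>2 / t * (of_int k)\<^sup>2 / 2))
       = fourier_coeff (periodized_gauss t) k * exp (2 * pi * \<i> * of_int k * w)"
      by (simp add: periodized_gauss_fourier_coeff[OF assms, of k])
  qed
  ultimately show ?thesis
    using fourier_series_entire[OF periodized_gauss_holomorphic[OF assms] periodized_gauss_periodic, where w = w]
      LIMSEQ_unique by auto
qed

text \<open>
  The value is \<open>\<surd>(2 \<pi> / t)\<close> if \<open>Re t > 0\<close>. The integral is kept because the limits below only ask for its
  behaviour under scaling and near \<open>t = 1\<close>, for which no branch of the root has to be chosen.
\<close>

definition gauss_integral :: "complex \<Rightarrow> complex" where
  "gauss_integral t = (LINT x|lborel. exp (- (t * (of_real x)\<^sup>2 / 2)))"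

lemma integrable_gauss:
  fixes t :: complex
  assumes "Re t > 0"
  shows "integrable lborel (\<lambda>x::real. exp (- (t * (of_real x)\<^sup>2 / 2)))"
proof (rule Bochner_Integration.integrable_bound)
  define \<sigma> where "\<sigma> = 1 / sqrt (Re t)"
  show "integrable lborel (\<lambda>x. sqrt (2 * pi * \<sigma>\<^sup>2) * normal_density 0 \<sigma> x)"
    using assms by (intro integrable_mult_right integrable_normal_density) (simp add: \<sigma>_def)
  show "AE x in lborel. norm (exp (- (t * (of_real x)\<^sup>2 / 2))) \<le> norm (sqrt (2 * pi * \<sigma>\<^sup>2) * normal_density 0 \<sigma> x)"
  proof (rule AE_I2)
    fix x :: real
    have "Re (- (t * (of_real x)\<^sup>2 / 2)) = - (Re t * x\<^sup>2 / 2)"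
      by (simp flip: of_real_power)
    moreover have "sqrt (2 * pi * \<sigma>\<^sup>2) * normal_density 0 \<sigma> x = exp (- (Re t * x\<^sup>2 / 2))"
      using assms by (simp add: normal_density_def \<sigma>_def power_divide field_simps)
    ultimately show "norm (exp (- (t * (of_real x)\<^sup>2 / 2))) \<le> norm (sqrt (2 * pi * \<sigma>\<^sup>2) * normal_density 0 \<sigma> x)"
      by simp
  qed
qed (auto intro!: borel_measurable_continuous_onI continuous_intros)

text \<open>
  Unfolding: the unit intervals shifted by the integers fill the real line.
\<close>

lemma periodized_gauss_mean:
  fixes t :: complex
  assumes "Re t > 0"
  shows "fourier_coeff (periodized_gauss t) 0 = gauss_integral t"
proof -
  define g where "g = (\<lambda>z::complex. exp (- (t * z\<^sup>2 / 2)))"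
  have "g holomorphic_on UNIV" unfolding g_def by (intro holomorphic_intros) auto
  then obtain P where "\<And>z. (P has_field_derivative g z) (at z within UNIV)"
    using holomorphic_convex_primitive'[OF convex_UNIV open_UNIV] by auto
  then have P: "(P has_field_derivative g z) (at z)" for z by simp
  have ftc: "((\<lambda>x. g (of_real x + s)) has_integral P (of_real b + s) - P (of_real a + s)) {a..b}"
    if "a \<le> b" for a b s
  proof (rule fundamental_theorem_of_calculus[OF that])
    fix x :: real
    have "((\<lambda>z. P (z + s)) has_field_derivative g (of_real x + s)) (at (of_real x))"
      using P DERIV_shift[of P "g (of_real x + s)" "of_real x" s] by simp
    then show "((\<lambda>x. P (of_real x + s)) has_vector_derivative g (of_real x + s)) (at x within {a..b})"
      using has_vector_derivative_real_field has_vector_derivative_at_within by blast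
  qed
\<comment> \<open>The integral over \<open>[- n, n + 1]\<close>; both sides are shown to be its limit.\<close>
  define D where "D = (\<lambda>n::nat. P (of_nat n + 1) - P (- of_nat n))"
  have "D \<longlonglongrightarrow> fourier_coeff (periodized_gauss t) 0"
  proof -
    have ul: "uniform_limit {0..1} (\<lambda>X x. \<Sum>m\<in>X. g (of_real x - of_int m))
       (\<lambda>x. \<Sum>\<^sub>\<infinity>m. g (of_real x - of_int m)) (finite_subsets_at_top UNIV)"
    proof (rule Weierstrass_m_test_general)
      show "(\<lambda>m. exp (Re t * \<bar>real_of_int m\<bar> - Re t * (real_of_int m)\<^sup>2 / 2)) summable_on UNIV"
        by (rule summable_on_gauss_majorant[OF assms])
      fix m :: int and x :: real assume x: "x \<in> {0..1}"
      have "x * real_of_int m \<le> 1 * \<bar>real_of_int m\<bar>"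
        using x by (intro order.trans[OF mult_left_mono[OF abs_ge_self] mult_right_mono]) auto
      moreover have "(x - real_of_int m)\<^sup>2 = x\<^sup>2 - 2 * (x * real_of_int m) + (real_of_int m)\<^sup>2"
        by (simp add: power2_eq_square algebra_simps)
      ultimately have "(x - real_of_int m)\<^sup>2 \<ge> (real_of_int m)\<^sup>2 - 2 * \<bar>real_of_int m\<bar>"
        using zero_le_power2[of x] by linarith
      then have "Re t * (x - real_of_int m)\<^sup>2 \<ge> Re t * ((real_of_int m)\<^sup>2 - 2 * \<bar>real_of_int m\<bar>)"
        using assms by (intro mult_left_mono) auto
      moreover have "Re (- (t * (of_real x - of_int m)\<^sup>2 / 2)) = - (Re t * (x - real_of_int m)\<^sup>2 / 2)"
      proof -
        have "(of_real x - of_int m)\<^sup>2 = complex_of_real ((x - real_of_int m)\<^sup>2)" by simp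
        then show ?thesis by (simp del: of_real_power of_real_diff)
      qed
      ultimately show "norm (g (of_real x - of_int m)) \<le> exp (Re t * \<bar>real_of_int m\<bar> - Re t * (real_of_int m)\<^sup>2 / 2)"
        by (simp add: g_def algebra_simps)
    qed
    have ul': "uniform_limit {0..1} (\<lambda>n x. \<Sum>m\<in>{- int n..int n}. g (of_real x - of_int m))
       (\<lambda>x. periodized_gauss t (of_real x)) sequentially"
      using filterlim_compose[OF ul filterlim_symmetric_int_intervals]
      by (simp add: periodized_gauss_def g_def)
    have gc: "continuous_on S g" for S
      unfolding g_def by (intro continuous_intros) auto
    obtain I J where IJ: "\<And>n. ((\<lambda>x. \<Sum>m\<in>{- int n..int n}. g (of_real x - of_int m)) has_integral I n) {0..1}"
      "((\<lambda>x. periodized_gauss t (of_real x)) has_integral J) {0..1}" "I \<longlonglongrightarrow> J"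
    proof (rule uniform_limit_integral[OF ul'])
      show "continuous_on {0..1} (\<lambda>x. \<Sum>m\<in>{- int n..int n}. g (of_real x - of_int m))" for n
        by (intro continuous_intros continuous_on_compose2[OF gc]) auto
    qed (auto simp: that)
    have "I n = D n" for n
    proof -
      have "((\<lambda>x. \<Sum>m\<in>{- int n..int n}. g (of_real x - of_int m)) has_integral
        (\<Sum>m\<in>{- int n..int n}. P (of_real 1 + - of_int m) - P (of_real 0 + - of_int m))) {0..1}"
        using ftc[of 0 1 "- of_int _"] by (intro has_integral_sum) auto
      then have "I n = (\<Sum>m\<in>{- int n..int n}. P (of_real 1 + - of_int m) - P (of_real 0 + - of_int m))"
        using IJ(1) has_integral_unique by blast
      also have "\<dots> = (\<Sum>m\<in>{- int n..int n}. P (- of_int (m - 1)) - P (- of_int m))"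
        by simp
      also have "\<dots> = D n"
        by (subst sum_int_telescope[of "\<lambda>m. P (- of_int m)"]) (simp add: D_def add.commute)
      finally show ?thesis .
    qed
    moreover have "J = fourier_coeff (periodized_gauss t) 0"
      using IJ(2) by (simp add: fourier_coeff_def integral_unique)
    ultimately show ?thesis using IJ(3) by (simp add: ext[of I D])
  qed
  moreover have "D \<longlonglongrightarrow> gauss_integral t"
  proof -
    have "(\<lambda>n::nat. LINT x|lborel. indicator {- real n..real n + 1} x *\<^sub>R g (of_real x)) \<longlonglongrightarrow> (LINT x|lborel. g (of_real x))"
    proof (rule integral_dominated_convergence)
      show "integrable lborel (\<lambda>x::real. norm (g (of_real x)))"
        unfolding g_def by (intro integrable_norm integrable_gauss assms)
      show "AE x in lborel. (\<lambda>n. indicator {- real n..real n + 1} x *\<^sub>R g (of_real x)) \<longlonglongrightarrow> g (of_real x)"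
      proof (rule AE_I2)
        fix x :: real
        have "\<forall>\<^sub>F n in sequentially. indicator {- real n..real n + 1} x *\<^sub>R g (of_real x) = g (of_real x)"
          using eventually_ge_at_top[of "nat \<lceil>\<bar>x\<bar>\<rceil>"]
        proof eventually_elim
          case (elim n)
          then have "\<bar>x\<bar> \<le> real n" by linarith
          then have "x \<in> {- real n..real n + 1}" by auto
          then show ?case by simp
        qed
        then show "(\<lambda>n. indicator {- real n..real n + 1} x *\<^sub>R g (of_real x)) \<longlonglongrightarrow> g (of_real x)"
          by (rule tendsto_eventually)
      qed
      show "AE x in lborel. norm (indicator {- real n..real n + 1} x *\<^sub>R g (of_real x)) \<le> norm (g (of_real x))" for n
        by (intro AE_I2) (auto simp: indicator_def)
    qed (auto simp: g_def intro!: borel_measurable_continuous_onI continuous_intros)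
    moreover have "(LINT x|lborel. indicator {- real n..real n + 1} x *\<^sub>R g (of_real x)) = D n" for n
    proof -
      have "continuous_on {- real n..real n + 1} (\<lambda>x. g (of_real x))"
        unfolding g_def by (intro continuous_intros) auto
      then have "set_integrable lborel {- real n..real n + 1} (\<lambda>x. g (of_real x))"
        by (rule borel_integrable_atLeastAtMost')
      from set_borel_integral_eq_integral(2)[OF this]
      show ?thesis
        using integral_unique[OF ftc[of "- real n" "real n + 1" 0]] by (simp add: D_def set_lebesgue_integral_def)
    qed
    ultimately show ?thesis by (simp add: gauss_integral_def g_def)
  qed
  ultimately show ?thesis by (rule LIMSEQ_unique)
qed

lemma gauss_integral_scale:
  assumes "t \<noteq> 0"
  shows "of_real (sqrt (norm t)) * gauss_integral t = gauss_integral (t / of_real (norm t))"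
proof -
  have "gauss_integral (t / of_real (norm t)) = \<bar>sqrt (norm t)\<bar> *\<^sub>R
     (LINT x|lborel. exp (- (t / of_real (norm t) * (of_real (0 + sqrt (norm t) * x))\<^sup>2 / 2)))"
    unfolding gauss_integral_def using assms by (intro lborel_integral_real_affine) auto
  also have "(\<lambda>x::real. exp (- (t / of_real (norm t) * (of_real (0 + sqrt (norm t) * x))\<^sup>2 / 2)))
      = (\<lambda>x. exp (- (t * (of_real x)\<^sup>2 / 2)))"
    using assms by (simp add: power_mult_distrib flip: of_real_power)
  finally show ?thesis by (simp add: gauss_integral_def scaleR_conv_of_real)
qed

lemma gauss_integral_1: "gauss_integral 1 = of_real (sqrt (2 * pi))"
proof -
  have "(LINT x|lborel. exp (- (x\<^sup>2 / 2))) = sqrt (2 * pi)"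
  proof -
    have "(LINT x|lborel. std_normal_density x) = 1"
      using integral_std_normal_moment_even[of 0] by simp
    then show ?thesis
      by (simp add: std_normal_density_def field_simps)
  qed
  moreover have "exp (- (1 * (complex_of_real x)\<^sup>2 / 2)) = complex_of_real (exp (- (x\<^sup>2 / 2)))" for x
    by (simp flip: exp_of_real)
  ultimately show ?thesis
    unfolding gauss_integral_def by (simp only: integral_complex_of_real)
qed

lemma gauss_integral_tendsto_1:
  assumes "z \<longlonglongrightarrow> 1"
  shows "(\<lambda>n. gauss_integral (z n)) \<longlonglongrightarrow> gauss_integral 1"
proof -
  have "(\<lambda>n. Re (z n)) \<longlonglongrightarrow> 1"
    using tendsto_Re[OF assms] by simp
  then have "\<forall>\<^sub>F n in sequentially. 1 / 2 < Re (z n)"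
    by (rule order_tendstoD) simp
  then obtain k where k: "\<And>n. n \<ge> k \<Longrightarrow> 1 / 2 < Re (z n)"
    by (auto simp: eventually_sequentially)
  have "(\<lambda>n. gauss_integral (z (n + k))) \<longlonglongrightarrow> gauss_integral 1"
    unfolding gauss_integral_def
  proof (rule integral_dominated_convergence)
    show "integrable lborel (\<lambda>x::real. norm (exp (- ((1 / 2 :: complex) * (of_real x)\<^sup>2 / 2))))"
      by (intro integrable_norm integrable_gauss) simp
    show "AE x in lborel. norm (exp (- (z (n + k) * (complex_of_real x)\<^sup>2 / 2)))
        \<le> norm (exp (- ((1 / 2 :: complex) * (of_real x)\<^sup>2 / 2)))" for n
    proof (rule AE_I2)
      fix x :: real
      have "1 / 2 * x\<^sup>2 \<le> Re (z (n + k)) * x\<^sup>2"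
        using k[of "n + k"] by (intro mult_right_mono) auto
      then show "norm (exp (- (z (n + k) * (complex_of_real x)\<^sup>2 / 2)))
        \<le> norm (exp (- ((1 / 2 :: complex) * (of_real x)\<^sup>2 / 2)))"
        by (simp flip: of_real_power)
    qed
    show "AE x in lborel. (\<lambda>n. exp (- (z (n + k) * (complex_of_real x)\<^sup>2 / 2))) \<longlonglongrightarrow> exp (- (1 * (complex_of_real x)\<^sup>2 / 2))"
      by (intro AE_I2 tendsto_intros LIMSEQ_ignore_initial_segment assms) auto
  qed (auto intro!: borel_measurable_continuous_onI continuous_intros)
  then show ?thesis by (rule LIMSEQ_offset)
qed

section \<open>Twisting by a root of unity\<close>

text \<open>
  The coefficient of \<open>exp (- t s (s + 1) / 2 + s u)\<close> in \<open>H\<close> when \<open>q = \<omega> exp (- t)\<close>. Integer powers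
  avoid the conversion of the nonnegative exponent to a natural number.
\<close>

definition twist :: "complex \<Rightarrow> int \<Rightarrow> complex" where
  "twist \<omega> s = (-1) powi s * \<omega> powi (s * (s + 1) div 2)"

lemma norm_root_of_unity:
  assumes "primitive_root_of_unity b \<omega>"
  shows "norm \<omega> = 1"
proof -
  have "norm \<omega> ^ b = 1 ^ b" "b > 0"
    using assms by (auto simp: primitive_root_of_unity_def simp flip: norm_power)
  then show ?thesis using power_eq_imp_eq_base[of "norm \<omega>" b 1] by simp
qed

lemma norm_twist: "norm \<omega> = 1 \<Longrightarrow> norm (twist \<omega> s) = 1"
  by (simp add: twist_def norm_mult norm_power_int)

lemma twist_0 [simp]: "twist \<omega> 0 = 1"
  by (simp add: twist_def)

lemma twist_succ:
  assumes "\<omega> \<noteq> 0"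
  shows "twist \<omega> (s + 1) = - (\<omega> powi (s + 1)) * twist \<omega> s"
proof -
  have "(s + 1) * (s + 1 + 1) = s * (s + 1) + 2 * (s + 1)" by (simp add: algebra_simps)
  then have "(s + 1) * (s + 1 + 1) div 2 = s * (s + 1) div 2 + (s + 1)" by simp
  then show ?thesis
    using assms by (simp add: twist_def power_int_add)
qed

lemma twist_reflect:
  assumes "\<omega> \<noteq> 0"
  shows "twist \<omega> (- 1 - s) = - twist \<omega> s"
proof -
  have "(- 1 - s) * (- 1 - s + 1) = s * (s + 1)" by (simp add: algebra_simps)
  moreover have "(- 1 :: complex) powi (- 1 - s) = - ((- 1) powi s)"
    by (cases "even s") (auto simp: power_int_minus_left)
  ultimately show ?thesis by (simp add: twist_def)
qed

text \<open>
  For even \<open>b\<close> this is where primitivity enters: \<open>\<omega>\<close> raised to \<open>b / 2\<close> is a square root of 1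
  other than 1.
\<close>

lemma primitive_root_triangular_power:
  assumes "primitive_root_of_unity b \<omega>"
  shows "\<omega> powi (int b * (int b + 1) div 2) = (-1) ^ (b + 1)"
proof (cases "even b")
  case True
  then obtain m where m: "b = 2 * m" by (elim evenE)
  have b: "b \<ge> 1" "\<omega> ^ b = 1" "\<And>k. 0 < k \<Longrightarrow> k < b \<Longrightarrow> \<omega> ^ k \<noteq> 1"
    using assms by (auto simp: primitive_root_of_unity_def)
  have "\<omega> ^ m \<noteq> 1" using b m by auto
  moreover have "(\<omega> ^ m)\<^sup>2 = 1" using b m by (simp flip: power_mult add: mult.commute)
  ultimately have half: "\<omega> ^ m = - 1" using power2_eq_1_iff by blast
  have "int b * (int b + 1) div 2 = int (m * (2 * m + 1))" by (simp add: m algebra_simps)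
  then have "\<omega> powi (int b * (int b + 1) div 2) = (\<omega> ^ m) ^ (2 * m + 1)"
    by (simp only: power_int_of_nat power_mult)
  then show ?thesis using True by (simp add: half)
next
  case False
  then obtain m where m: "b = 2 * m + 1" by (elim oddE)
  have "int b * (int b + 1) = 2 * int (b * (m + 1))" by (simp add: m algebra_simps)
  then have "int b * (int b + 1) div 2 = int (b * (m + 1))" by simp
  then have "\<omega> powi (int b * (int b + 1) div 2) = (\<omega> ^ b) ^ (m + 1)"
    by (simp only: power_int_of_nat power_mult)
  then show ?thesis using False assms by (simp add: primitive_root_of_unity_def)
qed

text \<open>
  The sign is the reason why the frequency zero is absent from the inverted theta series, so
  that the theta series is exponentially small near \<open>\<omega>\<close>.
\<close>

lemma twist_antiperiodic:
  assumes "primitive_root_of_unity b \<omega>"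
  shows "twist \<omega> (s + int b) = - twist \<omega> s"
proof -
  have \<omega>: "\<omega> \<noteq> 0" using norm_root_of_unity[OF assms] by auto
  have "(s + int b) * (s + int b + 1) = s * (s + 1) + 2 * (int b * s) + int b * (int b + 1)"
    by (simp add: algebra_simps)
  moreover have "even (int b * (int b + 1))" by simp
  moreover have "even (s * (s + 1))" by simp
  ultimately have "(s + int b) * (s + int b + 1) div 2 = s * (s + 1) div 2 + int b * s + int b * (int b + 1) div 2"
    by (elim evenE) simp
  moreover have "\<omega> powi (int b * s) = 1"
    using assms by (simp add: power_int_mult primitive_root_of_unity_def)
  ultimately have "twist \<omega> (s + int b) = (-1) powi s * (-1) ^ b * (\<omega> powi (s * (s + 1) div 2) * (-1) ^ (b + 1))"
    using \<omega> by (simp add: twist_def power_int_add primitive_root_triangular_power[OF assms])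
  also have "\<dots> = (-1) powi s * \<omega> powi (s * (s + 1) div 2) * ((-1) ^ b * (-1) ^ (b + 1))"
    by (simp only: mult_ac)
  also have "(-1) ^ b * (-1) ^ (b + 1) = (- 1 :: complex)"
    by (simp flip: power_add mult_2)
  finally show ?thesis by (simp add: twist_def)
qed

lemma twist_antiperiodic_mult:
  assumes "primitive_root_of_unity b \<omega>"
  shows "twist \<omega> (s + int b * m) = (-1) powi m * twist \<omega> s"
proof (induction m rule: int_induct[where k = 0])
  case (step1 i)
  have "twist \<omega> (s + int b * (i + 1)) = - twist \<omega> (s + int b * i)"
    using twist_antiperiodic[OF assms, of "s + int b * i"] by (simp add: algebra_simps)
  then show ?case using step1 by (simp add: power_int_add)
next
  case (step2 i)
  have "twist \<omega> (s + int b * i) = - twist \<omega> (s + int b * (i - 1))"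
    using twist_antiperiodic[OF assms, of "s + int b * (i - 1)"] by (simp add: algebra_simps)
  then have "twist \<omega> (s + int b * (i - 1)) = - ((-1) powi i * twist \<omega> s)"
    using step2 by simp
  then show ?case by (simp add: power_int_diff)
qed simp

lemma twist_periodic:
  assumes "primitive_root_of_unity b \<omega>"
  shows "twist \<omega> (s + 2 * int b * m) = twist \<omega> s"
  using twist_antiperiodic_mult[OF assms, of s "2 * m"] by (simp add: power_int_minus_left mult_ac)

text \<open>
  The coefficient of the lowest frequency after inversion. The shift by \<open>1 / 2\<close> stems from
  completing the square in \<open>s (s + 1) / 2\<close>.
\<close>

definition twisted_gauss_sum :: "complex \<Rightarrow> nat \<Rightarrow> complex" where
  "twisted_gauss_sum \<omega> b = (\<Sum>r<b. twist \<omega> (int r) * exp (- (\<i> * pi * (of_nat r + 1 / 2) / of_nat b)))"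

lemma sum_lessThan_cyclic:
  fixes g :: "nat \<Rightarrow> complex"
  assumes "g b = g 0"
  shows "(\<Sum>r<b. g (Suc r)) = (\<Sum>r<b. g r)"
  using sum.lessThan_Suc_shift[of g b] sum.lessThan_Suc[of g b] assms by (simp add: add.commute)

text \<open>
  Put \<open>T j = \<Sum> \<omega>\<^bsup>j r\<^esup> a\<^sub>r\<close>, where the \<open>a\<^sub>r\<close> are the summands up to a common factor. Shifting \<open>r\<close> by one gives
  \<open>T j\<close> as a unit times \<open>T (j + 1)\<close>. If the Gauss sum vanished, then so would every \<open>T j\<close>,
  but orthogonality of the powers of \<open>\<omega>\<close> yields \<open>\<Sum> T j = b a\<^sub>0 = b\<close>.
\<close>

lemma twisted_gauss_sum_nonzero:
  assumes prim: "primitive_root_of_unity b \<omega>"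
  shows "twisted_gauss_sum \<omega> b \<noteq> 0"
proof
  assume zero: "twisted_gauss_sum \<omega> b = 0"
  have \<omega>: "\<omega> \<noteq> 0" using norm_root_of_unity[OF prim] by auto
  have b: "b \<ge> 1" "\<omega> ^ b = 1" "\<And>k. 0 < k \<Longrightarrow> k < b \<Longrightarrow> \<omega> ^ k \<noteq> 1"
    using prim by (auto simp: primitive_root_of_unity_def)
  define a where "a = (\<lambda>r::nat. twist \<omega> (int r) * exp (- (\<i> * pi * of_nat r / of_nat b)))"
  define T where "T = (\<lambda>j. \<Sum>r<b. \<omega> ^ (j * r) * a r)"
  have a_succ: "a (Suc r) = - exp (- (\<i> * pi / of_nat b)) * \<omega> ^ Suc r * a r" for r
  proof -
    have "twist \<omega> (int (Suc r)) = - (\<omega> ^ Suc r) * twist \<omega> (int r)"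
      using twist_succ[OF \<omega>, of "int r"] power_int_of_nat[of \<omega> "Suc r"] by (simp add: add.commute)
    moreover have "exp (- (\<i> * pi * of_nat (Suc r) / of_nat b)) = exp (- (\<i> * pi / of_nat b)) * exp (- (\<i> * pi * of_nat r / of_nat b))"
      unfolding exp_add[symmetric] by (intro arg_cong[of _ _ exp]) (simp add: algebra_simps add_divide_distrib)
    ultimately show ?thesis by (simp add: a_def)
  qed
  have a_b: "a b = a 0"
  proof -
    have "twist \<omega> (int b) = - 1" using twist_antiperiodic[OF prim, of 0] by simp
    moreover have "exp (- (\<i> * pi * of_nat b / of_nat b)) = -1"
      using b(1) by (simp add: exp_minus mult.commute[of \<i>])
    ultimately show ?thesis by (simp add: a_def)
  qed
  have rec: "T j = - exp (- (\<i> * pi / of_nat b)) * \<omega> ^ Suc j * T (Suc j)" for j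
  proof -
    have "T j = (\<Sum>r<b. \<omega> ^ (j * Suc r) * a (Suc r))"
      unfolding T_def
      by (rule sum_lessThan_cyclic[symmetric]) (simp add: a_b b(2) power_mult mult.commute[of j])
    also have "\<dots> = (\<Sum>r<b. - exp (- (\<i> * pi / of_nat b)) * \<omega> ^ Suc j * (\<omega> ^ (Suc j * r) * a r))"
      by (intro sum.cong refl) (simp add: a_succ power_add mult_ac)
    finally show ?thesis by (simp only: T_def sum_distrib_left)
  qed
  have "twisted_gauss_sum \<omega> b = exp (- (\<i> * pi / (2 * of_nat b))) * T 0"
    unfolding twisted_gauss_sum_def T_def a_def sum_distrib_left
  proof (intro sum.cong refl)
    fix r
    have "exp (- (\<i> * pi * (of_nat r + 1 / 2) / of_nat b)) =
        exp (- (\<i> * pi / (2 * of_nat b))) * exp (- (\<i> * pi * of_nat r / of_nat b))"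
      unfolding exp_add[symmetric] using b(1) by (intro arg_cong[of _ _ exp]) (simp add: field_simps)
    then show "twist \<omega> (int r) * exp (- (\<i> * pi * (of_nat r + 1 / 2) / of_nat b)) =
        exp (- (\<i> * pi / (2 * of_nat b))) * (\<omega> ^ (0 * r) * (twist \<omega> (int r) * exp (- (\<i> * pi * of_nat r / of_nat b))))"
      by simp
  qed
  then have "T 0 = 0" using zero by simp
  then have T0: "T j = 0" for j
  proof (induction j)
    case (Suc j)
    then show ?case using rec[of j] \<omega> by simp
  qed
  have "(\<Sum>j<b. T j) = (\<Sum>r<b. a r * (\<Sum>j<b. (\<omega> ^ r) ^ j))"
    unfolding T_def by (subst sum.swap) (simp add: sum_distrib_left mult_ac flip: power_mult)
  also have "\<dots> = (\<Sum>r<b. if r = 0 then of_nat b else 0)"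
  proof (intro sum.cong refl)
    fix r assume r: "r \<in> {..<b}"
    show "a r * (\<Sum>j<b. (\<omega> ^ r) ^ j) = (if r = 0 then of_nat b else 0)"
    proof (cases "r = 0")
      case False
      then have "\<omega> ^ r \<noteq> 1" using b r by simp
      moreover have "(\<omega> ^ r) ^ b = 1" using b(2) by (metis power_mult mult.commute power_one)
      ultimately have "(\<Sum>j<b. (\<omega> ^ r) ^ j) = 0" by (simp add: geometric_sum)
      then show ?thesis using False by simp
    qed (simp add: a_def)
  qed
  also have "\<dots> = of_nat b" using b(1) by simp
  finally show False using T0 b(1) by simp
qed

text \<open>
  The coefficient of the frequency opposite to the lowest one. The minus sign makes the two
  leading terms combine into a sine.
\<close>

lemma twisted_gauss_sum_reflect:
  assumes prim: "primitive_root_of_unity b \<omega>"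
  shows "(\<Sum>r<b. twist \<omega> (int r) * exp (\<i> * pi * (of_nat r + 1 / 2) / of_nat b)) = - twisted_gauss_sum \<omega> b"
proof -
  have \<omega>: "\<omega> \<noteq> 0" using norm_root_of_unity[OF prim] by auto
  have b: "b \<ge> 1" using prim by (auto simp: primitive_root_of_unity_def)
  have "twisted_gauss_sum \<omega> b = (\<Sum>r<b. twist \<omega> (int (b - Suc r)) * exp (- (\<i> * pi * (of_nat (b - Suc r) + 1 / 2) / of_nat b)))"
    unfolding twisted_gauss_sum_def by (rule sum.nat_diff_reindex[symmetric])
  also have "\<dots> = (\<Sum>r<b. - (twist \<omega> (int r) * exp (\<i> * pi * (of_nat r + 1 / 2) / of_nat b)))"
  proof (intro sum.cong refl)
    fix r assume "r \<in> {..<b}"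
    then have r: "Suc r \<le> b" by simp
    have "twist \<omega> (int (b - Suc r)) = twist \<omega> (int r)"
      using twist_antiperiodic[OF prim, of "- 1 - int r"] twist_reflect[OF \<omega>, of "int r"] r
      by (simp add: of_nat_diff algebra_simps)
    moreover have "exp (- (\<i> * pi * (of_nat (b - Suc r) + 1 / 2) / of_nat b)) = - exp (\<i> * pi * (of_nat r + 1 / 2) / of_nat b)"
    proof -
      have "- (\<i> * pi * (of_nat (b - Suc r) + 1 / 2) / of_nat b) = \<i> * pi * (of_nat r + 1 / 2) / of_nat b - \<i> * pi"
        using b r by (simp add: of_nat_diff field_simps)
      then show ?thesis by (simp add: exp_diff mult.commute[of \<i>])
    qed
    ultimately show "twist \<omega> (int (b - Suc r)) * exp (- (\<i> * pi * (of_nat (b - Suc r) + 1 / 2) / of_nat b))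
       = - (twist \<omega> (int r) * exp (\<i> * pi * (of_nat r + 1 / 2) / of_nat b))" by simp
  qed
  finally show ?thesis by (simp add: sum_negf)
qed

lemma exp_pi_of_int: "exp (\<i> * pi * of_int m) = (- 1) powi m"
proof (cases "even m")
  case True
  then obtain k where k: "m = 2 * k" by (elim evenE)
  have "\<i> * pi * of_int m = 0 + \<i> * (of_int k * (of_real pi * 2))" by (simp add: k)
  then show ?thesis using True by (simp only: exp_plus_2pin) simp
next
  case False
  then obtain k where k: "m = 2 * k + 1" by (elim oddE)
  have "\<i> * pi * of_int m = of_real pi * \<i> + \<i> * (of_int k * (of_real pi * 2))"
    by (simp add: k algebra_simps)
  then show ?thesis using False by (simp only: exp_plus_2pin exp_pi_i) simp
qed

text \<open>
  The factor \<open>(-1)\<^sup>m\<close> amounts to a translation of the argument by \<open>\<i> \<pi> / T\<close>, which moves the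
  dual frequencies from the integers to the half-integers.
\<close>

lemma alternating_gauss_transformation:
  fixes T :: complex
  assumes "Re T > 0"
  shows "(\<Sum>\<^sub>\<infinity>m::int. (-1) powi m * exp (- (T * (Y - of_int m)\<^sup>2 / 2)))
    = exp (\<i> * pi * Y - pi\<^sup>2 / (2 * T)) * gauss_integral T
      * gauss_series (\<lambda>_. 1) UNIV (4 * pi\<^sup>2 / T) (2 * pi * \<i> * Y - 2 * pi\<^sup>2 / T)"
proof -
  have T: "T \<noteq> 0" using assms by auto
  have "(-1) powi m * exp (- (T * (Y - of_int m)\<^sup>2 / 2))
     = exp (\<i> * pi * Y - pi\<^sup>2 / (2 * T)) * exp (- (T * (Y + \<i> * pi / T - of_int m)\<^sup>2 / 2))" for m :: int
  proof -
    have "(-1) powi m * exp (- (T * (Y - of_int m)\<^sup>2 / 2)) = exp (\<i> * pi * of_int m + - (T * (Y - of_int m)\<^sup>2 / 2))"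
      by (simp only: exp_add exp_pi_of_int)
    also have "\<i> * pi * of_int m + - (T * (Y - of_int m)\<^sup>2 / 2)
        = (\<i> * pi * Y - pi\<^sup>2 / (2 * T)) + - (T * (Y + \<i> * pi / T - of_int m)\<^sup>2 / 2)"
      using T by (simp add: power2_eq_square field_simps)
    finally show ?thesis by (simp only: exp_add)
  qed
  then have "(\<Sum>\<^sub>\<infinity>m::int. (-1) powi m * exp (- (T * (Y - of_int m)\<^sup>2 / 2)))
     = exp (\<i> * pi * Y - pi\<^sup>2 / (2 * T)) * periodized_gauss T (Y + \<i> * pi / T)"
    by (simp add: periodized_gauss_def infsum_cmult_right')
  also have "2 * pi * \<i> * (Y + \<i> * pi / T) = 2 * pi * \<i> * Y - 2 * pi\<^sup>2 / T"
    by (simp add: power2_eq_square algebra_simps)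
  then have "periodized_gauss T (Y + \<i> * pi / T) = gauss_integral T
      * gauss_series (\<lambda>_. 1) UNIV (4 * pi\<^sup>2 / T) (2 * pi * \<i> * Y - 2 * pi\<^sup>2 / T)"
    using periodized_gauss_transformation[OF assms, of "Y + \<i> * pi / T"] periodized_gauss_mean[OF assms] by simp
  finally show ?thesis by (simp add: mult_ac)
qed

lemma bij_betw_residue_quotient:
  assumes "b \<ge> (1::nat)"
  shows "bij_betw (\<lambda>(r, m). int r + int b * m) ({..<b} \<times> UNIV) UNIV"
proof (rule bij_betwI[where g = "\<lambda>s. (nat (s mod int b), s div int b)"])
  show "(\<lambda>s. (nat (s mod int b), s div int b)) \<in> UNIV \<rightarrow> {..<b} \<times> UNIV"
    using assms by (auto simp: nat_less_iff)
qed (use assms in \<open>auto simp: div_mult_self2\<close>)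

text \<open>
  Sorting the indices by their residue modulo \<open>b\<close> leaves in each class an alternating Gaussian
  series, because of the antiperiodicity of \<open>twist\<close>; each is then inverted.
\<close>

theorem twisted_theta_transformation:
  fixes t z T :: complex and Y :: "nat \<Rightarrow> complex"
  assumes prim: "primitive_root_of_unity b \<omega>" and t: "Re t > 0"
  defines "T \<equiv> t * (of_nat b)\<^sup>2"
  defines "Y \<equiv> (\<lambda>r. z / (t * of_nat b) - of_nat r / of_nat b)"
  shows "gauss_series (twist \<omega>) UNIV t z = exp (z\<^sup>2 / (2 * t) - pi\<^sup>2 / (2 * T)) * gauss_integral T *
     (\<Sum>r<b. twist \<omega> (int r) * exp (\<i> * pi * Y r)
        * gauss_series (\<lambda>_. 1) UNIV (4 * pi\<^sup>2 / T) (2 * pi * \<i> * Y r - 2 * pi\<^sup>2 / T))"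
proof -
  have b: "b \<ge> 1" using prim by (auto simp: primitive_root_of_unity_def)
  have t0: "t \<noteq> 0" using t by auto
  have T: "Re T > 0" using t b by (simp add: T_def flip: of_nat_power)
  define f where "f = (\<lambda>s. twist \<omega> s * exp (of_int s * z - t * (of_int s)\<^sup>2 / 2))"
  have sum_f: "f summable_on UNIV"
    unfolding f_def by (rule gauss_series_summable[of _ 1]) (use norm_twist norm_root_of_unity[OF prim] t in auto)
  have f_term: "f (int r + int b * m) = exp (z\<^sup>2 / (2 * t)) * twist \<omega> (int r)
      * ((-1) powi m * exp (- (T * (Y r - of_int m)\<^sup>2 / 2)))" for r m
  proof -
    have "of_int (int r + int b * m) * z - t * (of_int (int r + int b * m))\<^sup>2 / 2
        = z\<^sup>2 / (2 * t) + - (T * (Y r - of_int m)\<^sup>2 / 2)"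
      using t0 b by (simp add: T_def Y_def power2_eq_square field_simps)
    then show ?thesis
      unfolding f_def twist_antiperiodic_mult[OF prim] by (simp only: exp_add mult_ac)
  qed
  have "gauss_series (twist \<omega>) UNIV t z = infsum f UNIV"
    by (simp add: gauss_series_def f_def)
  also have "\<dots> = (\<Sum>\<^sub>\<infinity>(r, m)\<in>{..<b} \<times> UNIV. f (int r + int b * m))"
    using infsum_reindex_bij_betw[OF bij_betw_residue_quotient[OF b], of f] by (simp add: case_prod_unfold)
  also have "\<dots> = (\<Sum>\<^sub>\<infinity>r\<in>{..<b}. \<Sum>\<^sub>\<infinity>m. f (int r + int b * m))"
    using summable_on_reindex_bij_betw[OF bij_betw_residue_quotient[OF b], of f] sum_f
    by (intro infsum_Sigma'_banach[symmetric]) (simp add: case_prod_unfold)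
  also have "\<dots> = (\<Sum>r<b. \<Sum>\<^sub>\<infinity>m. f (int r + int b * m))"
    by (rule infsum_finite) simp
  also have "\<dots> = (\<Sum>r<b. exp (z\<^sup>2 / (2 * t)) * twist \<omega> (int r) *
      (exp (\<i> * pi * Y r - pi\<^sup>2 / (2 * T)) * gauss_integral T
      * gauss_series (\<lambda>_. 1) UNIV (4 * pi\<^sup>2 / T) (2 * pi * \<i> * Y r - 2 * pi\<^sup>2 / T)))"
    unfolding f_term by (simp add: infsum_cmult_right' alternating_gauss_transformation[OF T])
  also have "\<dots> = exp (z\<^sup>2 / (2 * t) - pi\<^sup>2 / (2 * T)) * gauss_integral T *
     (\<Sum>r<b. twist \<omega> (int r) * exp (\<i> * pi * Y r)
        * gauss_series (\<lambda>_. 1) UNIV (4 * pi\<^sup>2 / T) (2 * pi * \<i> * Y r - 2 * pi\<^sup>2 / T))"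
    unfolding sum_distrib_left by (intro sum.cong refl) (simp add: exp_diff mult_ac)
  finally show ?thesis .
qed

section \<open>The theta series and the tail of H\<close>

text \<open>
  The terms are \<open>exp (- p k (k + 1) / 2 + 2 \<pi> \<i> k Y)\<close>. For \<open>k = 0\<close> and \<open>k = -1\<close> the quadratic
  exponent vanishes; for all other \<open>k\<close> one has \<open>k (k + 1) / 2 \<ge> 1\<close>, so that for bounded \<open>Y\<close> and
  \<open>Re p \<ge> 1\<close> their sum is at most a constant times \<open>exp (- Re p)\<close>.
\<close>

lemma gauss_series_two_leading_terms:
  fixes p Y :: "nat \<Rightarrow> complex"
  assumes p: "filterlim (\<lambda>n. Re (p n)) at_top sequentially" and Y: "Y \<longlonglongrightarrow> y"
  shows "(\<lambda>n. gauss_series (\<lambda>_. 1) UNIV (p n) (2 * pi * \<i> * Y n - p n / 2)) \<longlonglongrightarrow> 1 + exp (- (2 * pi * \<i> * y))"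
proof -
  obtain M where M: "\<And>n. norm (Y n) \<le> M"
    using Y convergent_imp_Bseq[of Y] by (auto simp: convergent_def Bseq_def)
  define M' where "M' = 2 * pi * M + 1 / 2"
  define g where "g = (\<lambda>k::int. exp (M' * \<bar>real_of_int k\<bar> - 1 * (real_of_int k)\<^sup>2 / 2))"
  have g: "g summable_on A" for A
    unfolding g_def by (rule summable_on_gauss_majorant) simp
  define f where "f = (\<lambda>n k. 1 * exp (of_int k * (2 * pi * \<i> * Y n - p n / 2) - p n * (of_int k)\<^sup>2 / 2))"
  define B where "B = - {0, - 1 :: int}"
  have bound: "norm (f n k) \<le> exp (1 - Re (p n)) * g k" if n: "Re (p n) \<ge> 1" and k: "k \<in> B" for n k
  proof -
    have "k * (k + 1) \<ge> 2"
    proof (cases "k \<ge> 1")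
      case True
      then show ?thesis using mult_mono[of 1 k 2 "k + 1"] by simp
    next
      case False
      then have "- k \<ge> 2" using k by (auto simp: B_def)
      then show ?thesis using mult_mono[of 2 "- k" 1 "- k - 1"] by (simp add: algebra_simps)
    qed
    define X where "X = real_of_int (k * (k + 1))"
    have k2: "X \<ge> 2" using \<open>k * (k + 1) \<ge> 2\<close> unfolding X_def by linarith
    have "Re (of_int k * (2 * pi * \<i> * Y n - p n / 2) - p n * (of_int k)\<^sup>2 / 2)
       = - (2 * pi * (real_of_int k * Im (Y n))) - Re (p n) * (X / 2)"
      by (simp add: X_def power2_eq_square field_simps)
    also have "\<dots> \<le> 2 * pi * (M * \<bar>real_of_int k\<bar>) - (Re (p n) - 1 + X / 2)"
    proof -
      have "\<bar>real_of_int k * Im (Y n)\<bar> \<le> M * \<bar>real_of_int k\<bar>"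
        using mult_left_mono[OF order.trans[OF abs_Im_le_cmod M, of n], of "\<bar>real_of_int k\<bar>"]
        by (simp only: abs_mult mult.commute[of M] abs_ge_zero)
      then have "2 * pi * (- (real_of_int k * Im (Y n))) \<le> 2 * pi * (M * \<bar>real_of_int k\<bar>)"
        by (intro mult_left_mono) auto
      moreover have "2 * pi * (- (real_of_int k * Im (Y n))) = - (2 * pi * (real_of_int k * Im (Y n)))"
        by simp
      moreover have "(Re (p n) - 1) * (X / 2 - 1) \<ge> 0"
        using n k2 by (intro mult_nonneg_nonneg) auto
      moreover have "(Re (p n) - 1) * (X / 2 - 1) = Re (p n) * (X / 2) - Re (p n) - X / 2 + 1"
        by (simp add: field_simps)
      ultimately show ?thesis by linarith
    qed
    also have "\<dots> \<le> (1 - Re (p n)) + (M' * \<bar>real_of_int k\<bar> - 1 * (real_of_int k)\<^sup>2 / 2)"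
      by (simp add: M'_def X_def power2_eq_square field_simps)
    finally show ?thesis
      by (simp add: f_def g_def flip: exp_add)
  qed
  have "(\<lambda>n. infsum (f n) B) \<longlonglongrightarrow> 0"
  proof (rule Lim_null_comparison)
    have "(\<lambda>n. exp (- Re (p n))) \<longlonglongrightarrow> 0"
      using p by (intro filterlim_compose[OF exp_at_bot]) (simp add: filterlim_uminus_at_top)
    then have "(\<lambda>n. exp 1 * exp (- Re (p n))) \<longlonglongrightarrow> 0"
      by (rule tendsto_mult_right_zero)
    then show "(\<lambda>n. exp (1 - Re (p n)) * infsum g B) \<longlonglongrightarrow> 0"
      by (intro tendsto_mult_left_zero) (simp flip: exp_add)
    have "\<forall>\<^sub>F n in sequentially. Re (p n) \<ge> 1"
      using p by (auto simp: filterlim_at_top)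
    then show "\<forall>\<^sub>F n in sequentially. norm (infsum (f n) B) \<le> exp (1 - Re (p n)) * infsum g B"
    proof eventually_elim
      case (elim n)
      have s: "(\<lambda>k. exp (1 - Re (p n)) * g k) summable_on B"
        by (intro summable_on_cmult_right g)
      have a: "(\<lambda>k. norm (f n k)) summable_on B"
        by (rule summable_on_comparison_test[OF s]) (use bound[OF elim] in auto)
      have "norm (infsum (f n) B) \<le> infsum (\<lambda>k. norm (f n k)) B"
        by (rule norm_infsum_bound[OF a])
      also have "\<dots> \<le> infsum (\<lambda>k. exp (1 - Re (p n)) * g k) B"
        by (rule infsum_mono[OF a s bound[OF elim]])
      finally show ?case by (simp add: infsum_cmult_right')
    qed
  qed
  moreover have "(\<lambda>n. 1 + exp (- (2 * pi * \<i> * Y n))) \<longlonglongrightarrow> 1 + exp (- (2 * pi * \<i> * y))"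
    by (intro tendsto_intros Y)
  ultimately have "(\<lambda>n. 1 + exp (- (2 * pi * \<i> * Y n)) + infsum (f n) B) \<longlonglongrightarrow> 1 + exp (- (2 * pi * \<i> * y)) + 0"
    by (rule tendsto_add[rotated])
  moreover have "\<forall>\<^sub>F n in sequentially. 1 + exp (- (2 * pi * \<i> * Y n)) + infsum (f n) B
      = gauss_series (\<lambda>_. 1) UNIV (p n) (2 * pi * \<i> * Y n - p n / 2)"
  proof -
    have "\<forall>\<^sub>F n in sequentially. Re (p n) \<ge> 1"
      using p by (auto simp: filterlim_at_top)
    then show ?thesis
    proof eventually_elim
      case (elim n)
      have sf: "f n summable_on A" for A
        unfolding f_def by (rule gauss_series_summable[of "\<lambda>_. 1" 1]) (use elim in auto)
      have "gauss_series (\<lambda>_. 1) UNIV (p n) (2 * pi * \<i> * Y n - p n / 2) = infsum (f n) ({0, -1} \<union> B)"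
        by (simp add: gauss_series_def f_def B_def)
      also have "\<dots> = infsum (f n) {0, -1} + infsum (f n) B"
        by (rule infsum_Un_disjoint) (auto simp: B_def intro: sf)
      also have "infsum (f n) {0, -1} = 1 + exp (- (2 * pi * \<i> * Y n))"
        by (simp add: f_def)
      finally show ?case ..
    qed
  qed
  ultimately show ?thesis
    by (simp add: Lim_transform_eventually)
qed

text \<open>
  The limit, up to sign, of the normalised tail of \<open>H\<close> as \<open>N\<close> tends to infinity in the residue class of
  \<open>a\<close> modulo \<open>2 b\<close>.
\<close>

definition tail_limit :: "nat \<Rightarrow> complex \<Rightarrow> int \<Rightarrow> complex" where
  "tail_limit b \<omega> a = gauss_series (\<lambda>j. twist \<omega> (a + j)) {0..} 0 (- of_real (pi / b))"

lemma tail_limit_rec: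
  assumes prim: "primitive_root_of_unity b \<omega>"
  shows "tail_limit b \<omega> a = twist \<omega> a + exp (- of_real (pi / b)) * tail_limit b \<omega> (a + 1)"
proof -
  have b: "b \<ge> 1" using prim by (auto simp: primitive_root_of_unity_def)
  define f where "f = (\<lambda>a j. twist \<omega> (a + j) * exp (of_int j * (- of_real (pi / b)) - 0 * (of_int j)\<^sup>2 / 2))"
  have sf: "f a summable_on A" if "A \<subseteq> {0..}" for a A
  proof (rule abs_summable_summable, rule summable_on_comparison_test)
    show "(\<lambda>s. exp (- (pi / b) * \<bar>real_of_int s\<bar>)) summable_on A"
      by (rule summable_on_exp_neg_abs_int) (use b in auto)
    fix j assume "j \<in> A"
    then have "real_of_int j \<ge> 0" using that by auto
    then show "norm (f a j) \<le> exp (- (pi / b) * \<bar>real_of_int j\<bar>)"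
      by (simp add: f_def norm_mult norm_twist norm_root_of_unity[OF prim] mult.commute)
  qed simp
  have "{0..} = {0} \<union> {1::int..}" by auto
  then have "tail_limit b \<omega> a = infsum (f a) ({0} \<union> {1..})"
    by (simp add: tail_limit_def gauss_series_def f_def)
  also have "\<dots> = infsum (f a) {0} + infsum (f a) {1..}"
    by (rule infsum_Un_disjoint) (auto intro!: sf)
  also have "infsum (f a) {1..} = infsum (\<lambda>j. f a (j + 1)) {0..}"
    by (rule infsum_reindex_bij_betw[symmetric], rule bij_betwI[where g = "\<lambda>j. j - 1"]) auto
  also have "\<dots> = infsum (\<lambda>j. exp (- of_real (pi / b)) * f (a + 1) j) {0..}"
  proof (intro infsum_cong)
    fix j :: int
    have "exp (of_int (j + 1) * (- of_real (pi / b)) - 0 * (of_int (j + 1))\<^sup>2 / 2 :: complex)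
        = exp (- of_real (pi / b)) * exp (of_int j * (- of_real (pi / b)) - 0 * (of_int j)\<^sup>2 / 2)"
      unfolding exp_add[symmetric] by (intro arg_cong[of _ _ exp]) (simp add: algebra_simps add_divide_distrib)
    then show "f a (j + 1) = exp (- of_real (pi / b)) * f (a + 1) j"
      unfolding f_def by (simp only: mult_ac add_ac)
  qed
  finally show ?thesis
    by (simp add: infsum_cmult_right' tail_limit_def gauss_series_def f_def)
qed

text \<open>
  By the recursion, two consecutive zeros would force \<open>twist \<omega> 1 = 0\<close>.
\<close>

lemma tail_limit_nonzero:
  assumes prim: "primitive_root_of_unity b \<omega>"
  obtains a :: nat where "a \<ge> 1" "tail_limit b \<omega> (int a) \<noteq> 0"
proof -
  have "twist \<omega> 1 \<noteq> 0"
    using norm_twist[OF norm_root_of_unity[OF prim], of 1] by auto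
  then have "tail_limit b \<omega> (int 1) \<noteq> 0 \<or> tail_limit b \<omega> (int 2) \<noteq> 0"
    using tail_limit_rec[OF prim, of 1] by auto
  then show ?thesis using that[of 1] that[of 2] by auto
qed

lemma H_eq_gauss_series:
  "H N (\<omega> * exp (- t)) u = gauss_series (twist \<omega>) {- int N..} t (u - t / 2)"
  unfolding H_def gauss_series_def
proof (intro infsum_cong)
  fix s :: int
  define n where "n = s * (s + 1) div 2"
  have n0: "n \<ge> 0"
    unfolding n_def by (cases "s \<ge> 0") (auto simp: mult_nonpos_nonpos pos_imp_zdiv_nonneg_iff)
  have "2 * n = s * (s + 1)" by (simp add: n_def)
  then have "2 * complex_of_int n = of_int s * (of_int s + 1)"
    by (metis of_int_1 of_int_add of_int_mult of_int_numeral)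
  then have n: "complex_of_int n = (of_int s * (of_int s + 1)) / 2"
    by (metis nonzero_mult_div_cancel_left zero_neq_numeral)
  have "(\<omega> * exp (- t)) ^ nat n = \<omega> powi n * exp (of_int n * (- t))"
    using n0 by (simp add: power_mult_distrib power_int_def flip: exp_of_nat_mult)
  then have "(- 1) powi s * (\<omega> * exp (- t)) ^ nat n * exp (of_int s * u)
      = twist \<omega> s * (exp (of_int n * (- t)) * exp (of_int s * u))"
    by (simp add: twist_def n_def)
  also have "exp (of_int n * (- t)) * exp (of_int s * u) = exp (of_int s * (u - t / 2) - t * (of_int s)\<^sup>2 / 2)"
    unfolding exp_add[symmetric] n by (intro arg_cong[of _ _ exp]) (simp add: power2_eq_square field_simps)
  finally show "(- 1) powi s * (\<omega> * exp (- t)) ^ nat (s * (s + 1) div 2) * exp (of_int s * u) =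
         twist \<omega> s * exp (of_int s * (u - t / 2) - t * (of_int s)\<^sup>2 / 2)"
    by (simp only: n_def)
qed

text \<open>
  The factor \<open>E\<close> is chosen such that the leading term of the tail, at \<open>s = - N - 1\<close>, becomes \<open>- twist \<omega> N\<close>.
  The sign of the tail is absorbed by the reflection \<open>s \<mapsto> - 1 - s\<close>.
\<close>

lemma H_eq_theta_minus_tail:
  fixes t u E :: complex and N :: nat
  assumes prim: "primitive_root_of_unity b \<omega>" and t: "Re t > 0"
  defines "E \<equiv> exp (t * (of_nat N * (of_nat N + 1)) / 2 + (of_nat N + 1) * u)"
  shows "E * H N (\<omega> * exp (- t)) u = E * gauss_series (twist \<omega>) UNIV t (u - t / 2)
     + gauss_series (\<lambda>j. twist \<omega> (int N + j)) {0..} t (- u - t * of_nat N - t / 2)"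
proof -
  have \<omega>: "\<omega> \<noteq> 0" using norm_root_of_unity[OF prim] by auto
  define f where "f = (\<lambda>s. twist \<omega> s * exp (of_int s * (u - t / 2) - t * (of_int s)\<^sup>2 / 2))"
  have sf: "f summable_on A" for A
    unfolding f_def by (rule gauss_series_summable[of _ 1]) (use norm_twist norm_root_of_unity[OF prim] t in auto)
  have "UNIV = {- int N..} \<union> {..< - int N}" by auto
  then have "gauss_series (twist \<omega>) UNIV t (u - t / 2) = infsum f ({- int N..} \<union> {..< - int N})"
    by (simp add: gauss_series_def f_def)
  also have "\<dots> = infsum f {- int N..} + infsum f {..< - int N}"
    by (rule infsum_Un_disjoint) (auto intro: sf)
  also have "infsum f {- int N..} = H N (\<omega> * exp (- t)) u"
    by (simp add: H_eq_gauss_series gauss_series_def f_def)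
  also have "infsum f {..< - int N} = infsum (\<lambda>j. f (- 1 - (int N + j))) {0..}"
    by (rule infsum_reindex_bij_betw[symmetric], rule bij_betwI[where g = "\<lambda>s. - 1 - int N - s"]) auto
  finally have "E * gauss_series (twist \<omega>) UNIV t (u - t / 2)
      = E * H N (\<omega> * exp (- t)) u + infsum (\<lambda>j. E * f (- 1 - (int N + j))) {0..}"
    by (simp add: infsum_cmult_right' ring_distribs)
  moreover have "E * f (- 1 - (int N + j)) =
      - (twist \<omega> (int N + j) * exp (of_int j * (- u - t * of_nat N - t / 2) - t * (of_int j)\<^sup>2 / 2))" for j
  proof -
    have "E * exp (of_int (- 1 - (int N + j)) * (u - t / 2) - t * (of_int (- 1 - (int N + j)))\<^sup>2 / 2)
      = exp (of_int j * (- u - t * of_nat N - t / 2) - t * (of_int j)\<^sup>2 / 2)"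
      unfolding E_def exp_add[symmetric]
      by (intro arg_cong[of _ _ exp]) (simp add: power2_eq_square field_simps)
    then show ?thesis
      unfolding f_def twist_reflect[OF \<omega>] by (simp add: mult.left_commute)
  qed
  ultimately show ?thesis
    by (simp add: infsum_uminus gauss_series_def)
qed

section \<open>Persistence of a nondegenerate double point\<close>

text \<open>
  On a compact set with continuous limit, uniform convergence can be tested along convergent
  sequences of points. This reduces the uniform asymptotics in two complex parameters to
  ordinary limits. The subsequence \<open>\<phi>\<close> is needed since a counterexample to uniformity only
  exists for infinitely many indices.
\<close>

lemma uniform_limit_compactI:
  fixes f :: "nat \<Rightarrow> 'a::metric_space \<Rightarrow> 'b::metric_space"
  assumes K: "compact K" and g: "continuous_on K g"
    and seq: "\<And>\<phi> x l. strict_mono \<phi> \<Longrightarrow> (\<And>n. x n \<in> K) \<Longrightarrow> x \<longlonglongrightarrow> l \<Longrightarrow> l \<in> K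
      \<Longrightarrow> (\<lambda>n. f (\<phi> n) (x n)) \<longlonglongrightarrow> g l"
  shows "uniform_limit K f g sequentially"
proof (rule ccontr)
  assume "\<not> ?thesis"
  then obtain e where e: "e > 0" "\<not> (\<forall>\<^sub>F n in sequentially. \<forall>x\<in>K. dist (f n x) (g x) < e)"
    unfolding uniform_limit_iff by blast
  then have "\<exists>\<^sub>F n in sequentially. \<exists>x\<in>K. dist (f n x) (g x) \<ge> e"
    by (simp add: not_eventually not_less)
  then have "infinite {n. \<exists>x\<in>K. dist (f n x) (g x) \<ge> e}"
    by (simp add: frequently_cofinite[symmetric] cofinite_eq_sequentially)
  then obtain \<phi> :: "nat \<Rightarrow> nat" where \<phi>: "strict_mono \<phi>" "\<And>n. \<phi> n \<in> {n. \<exists>x\<in>K. dist (f n x) (g x) \<ge> e}"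
    using infinite_enumerate by blast
  then have "\<forall>n. \<exists>x\<in>K. dist (f (\<phi> n) x) (g x) \<ge> e" by blast
  then obtain x where x: "\<And>n. x n \<in> K" "\<And>n. dist (f (\<phi> n) (x n)) (g (x n)) \<ge> e"
    by metis
  obtain l r where l: "l \<in> K" "strict_mono r" "(x \<circ> r) \<longlonglongrightarrow> l"
    using K x(1) unfolding compact_def by blast
  have "(\<lambda>n. f ((\<phi> \<circ> r) n) ((x \<circ> r) n)) \<longlonglongrightarrow> g l"
    by (rule seq[OF strict_mono_o[OF \<phi>(1) l(2)] _ l(3,1)]) (simp add: x)
  moreover have "(\<lambda>n. g ((x \<circ> r) n)) \<longlonglongrightarrow> g l"
    by (rule continuous_on_tendsto_compose[OF g l(3,1)]) (simp add: x)
  ultimately have "(\<lambda>n. dist (f ((\<phi> \<circ> r) n) ((x \<circ> r) n)) (g ((x \<circ> r) n))) \<longlonglongrightarrow> dist (g l) (g l)"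
    by (rule tendsto_dist)
  then have "\<forall>\<^sub>F n in sequentially. dist (f ((\<phi> \<circ> r) n) ((x \<circ> r) n)) (g ((x \<circ> r) n)) < e"
    using e(1) by (intro order_tendstoD(2)) auto
  then show False
    using x(2) by (auto simp: eventually_sequentially not_less[symmetric])
qed

lemma norm_deriv_le:
  assumes "f holomorphic_on UNIV" "\<And>w. norm (z - w) = 1 \<Longrightarrow> norm (f w) \<le> B"
  shows "norm (deriv f z) \<le> B"
  using Cauchy_inequality[of f z 1 B 1] assms
  by (auto intro: holomorphic_on_subset holomorphic_on_imp_continuous_on)

text \<open>
  By Cauchy's inequality the derivative in \<open>v\<close> is controlled by the values on a circle of radius
  1, which is why the domain shrinks from radius 2 to radius 1.
\<close>

lemma continuous_on_deriv_snd:
  fixes f :: "complex \<Rightarrow> complex \<Rightarrow> complex"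
  assumes cont: "continuous_on (cball 0 2 \<times> cball 0 2) (\<lambda>(w, v). f w v)"
    and hol: "\<And>w. w \<in> cball 0 2 \<Longrightarrow> f w holomorphic_on UNIV"
  shows "continuous_on (cball 0 1 \<times> cball 0 1) (\<lambda>(w, v). deriv (f w) v)"
  unfolding continuous_on_sequentially
proof (intro allI ballI impI, elim conjE)
  fix x :: "nat \<Rightarrow> complex \<times> complex" and l
  assume l: "l \<in> cball 0 1 \<times> cball 0 1" and x: "\<forall>n. x n \<in> cball 0 1 \<times> cball 0 1" and lim: "x \<longlonglongrightarrow> l"
  obtain w0 v0 where l_eq: "l = (w0, v0)" by (cases l)
  have uc: "uniformly_continuous_on (cball 0 2 \<times> cball 0 2) (\<lambda>(w, v). f w v)"
    by (intro compact_uniformly_continuous cont compact_Times compact_cball)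
  have fst_lim: "(\<lambda>n. fst (x n)) \<longlonglongrightarrow> w0" and snd_lim: "(\<lambda>n. snd (x n)) \<longlonglongrightarrow> v0"
    using lim l_eq by (auto dest: tendsto_fst tendsto_snd)
  have w0: "w0 \<in> cball 0 2" using l by (auto simp: l_eq)
  have xw: "fst (x n) \<in> cball 0 2" "snd (x n) \<in> cball 0 1" for n using x by (auto simp: mem_Times_iff intro: order.trans)
  have small: "(\<lambda>n. deriv (f (fst (x n))) (snd (x n)) - deriv (f w0) (snd (x n))) \<longlonglongrightarrow> 0"
  proof (rule tendstoI)
    fix e :: real assume "e > 0"
    then obtain d where d: "d > 0" "\<And>p q. p \<in> cball 0 2 \<times> cball 0 2 \<Longrightarrow> q \<in> cball 0 2 \<times> cball 0 2 \<Longrightarrow> dist q p < d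
        \<Longrightarrow> dist ((\<lambda>(w, v). f w v) q) ((\<lambda>(w, v). f w v) p) < e / 2"
      using uc unfolding uniformly_continuous_on_def by (metis half_gt_zero)
    have "\<forall>\<^sub>F n in sequentially. dist (fst (x n)) w0 < d"
      using fst_lim d(1) by (rule tendstoD)
    then show "\<forall>\<^sub>F n in sequentially. dist (deriv (f (fst (x n))) (snd (x n)) - deriv (f w0) (snd (x n))) 0 < e"
    proof eventually_elim
      case (elim n)
      have "norm (deriv (\<lambda>v. f (fst (x n)) v - f w0 v) (snd (x n))) \<le> e / 2"
      proof (rule norm_deriv_le)
        show "(\<lambda>v. f (fst (x n)) v - f w0 v) holomorphic_on UNIV"
          by (intro holomorphic_intros hol xw w0)
        fix v assume "norm (snd (x n) - v) = 1"
        then have "norm v \<le> 2"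
          using xw(2)[of n] norm_triangle_ineq4[of "snd (x n)" "snd (x n) - v"] by simp
        then show "norm (f (fst (x n)) v - f w0 v) \<le> e / 2"
          using d(2)[of "(w0, v)" "(fst (x n), v)"] elim w0 xw(1)[of n]
          by (simp add: dist_Pair_Pair dist_norm)
      qed
      also have "deriv (\<lambda>v. f (fst (x n)) v - f w0 v) (snd (x n)) = deriv (f (fst (x n))) (snd (x n)) - deriv (f w0) (snd (x n))"
        by (intro deriv_diff holomorphic_on_imp_differentiable_at[OF hol open_UNIV] xw w0 UNIV_I)
      finally show ?case using \<open>e > 0\<close> by simp
    qed
  qed
  have "continuous_on UNIV (deriv (f w0))"
    by (intro holomorphic_on_imp_continuous_on holomorphic_deriv hol w0) auto
  then have "(\<lambda>n. deriv (f w0) (snd (x n))) \<longlonglongrightarrow> deriv (f w0) v0"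
    by (rule continuous_on_tendsto_compose[OF _ snd_lim]) auto
  from tendsto_add[OF small this]
  show "((\<lambda>(w, v). deriv (f w) v) \<circ> x) \<longlonglongrightarrow> (\<lambda>(w, v). deriv (f w) v) l"
    by (simp add: l_eq case_prod_unfold o_def)
qed

text \<open>
  The scaling limit of the ratio of the theta series to the tail, recentred so that its critical
  point is \<open>w = v = 0\<close>. There the value is 1 and the derivative in \<open>v\<close> is 0.
\<close>

definition model :: "complex \<Rightarrow> complex \<Rightarrow> complex" where
  "model w v = exp (w + v) * (cos v - sin v)"

lemma deriv_model: "deriv (model w) v = - 2 * exp (w + v) * sin v"
  unfolding model_def
  by (rule DERIV_imp_deriv) (auto intro!: derivative_eq_intros simp: algebra_simps)

text \<open>
  A simplified Newton step for the system \<open>model w v = 1\<close>, \<open>deriv (model w) v = 0\<close>. At the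
  origin the Jacobian of the system is diagonal with entries \<open>1\<close> and \<open>-2\<close>; the step divides by these entries.
\<close>

definition model_step :: "complex \<times> complex \<Rightarrow> complex \<times> complex" where
  "model_step = (\<lambda>(w, v). (w - (model w v - 1), v - exp (w + v) * sin v))"

text \<open>
  The derivative of a Newton step at the solution is zero.
\<close>

lemma model_step_contracting:
  obtains r where "0 < r" "r \<le> 1" "\<And>p. norm p \<le> r \<Longrightarrow> norm (model_step p) \<le> norm p / 2"
proof -
  have expd: "((\<lambda>p. exp (fst p + snd p)) has_derivative (\<lambda>h. fst h + snd h)) (at (0 :: complex \<times> complex))"
    by (rule has_derivative_eq_rhs, rule has_derivative_compose[where g = exp and g' = "\<lambda>h. 1 * h", OF _ has_field_derivative_imp_has_derivative])
      (auto intro!: derivative_eq_intros simp: fun_eq_iff)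
  have sind: "((\<lambda>p. sin (snd p)) has_derivative (\<lambda>h. snd h)) (at (0 :: complex \<times> complex))"
    by (rule has_derivative_eq_rhs, rule has_derivative_compose[where g = sin and g' = "\<lambda>h. 1 * h", OF _ has_field_derivative_imp_has_derivative])
      (auto intro!: derivative_eq_intros simp: fun_eq_iff)
  have cosd: "((\<lambda>p. cos (snd p)) has_derivative (\<lambda>h. 0)) (at (0 :: complex \<times> complex))"
    by (rule has_derivative_eq_rhs, rule has_derivative_compose[where g = cos and g' = "\<lambda>h. 0 * h", OF _ has_field_derivative_imp_has_derivative])
      (auto intro!: derivative_eq_intros simp: fun_eq_iff)
  have "(model_step has_derivative (\<lambda>h. 0)) (at 0)"
    unfolding model_step_def model_def case_prod_unfold
    by (rule has_derivative_eq_rhs)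
      (rule derivative_intros expd sind cosd has_derivative_ident has_derivative_fst has_derivative_snd has_derivative_const | simp add: fun_eq_iff zero_prod_def)+
  then obtain d where d: "d > 0" "\<And>p. norm (p - 0) < d \<Longrightarrow> norm (model_step p - model_step 0 - 0) \<le> 1 / 2 * norm (p - 0)"
    unfolding has_derivative_at_alt by (metis half_gt_zero zero_less_one)
  have "model_step 0 = 0" by (simp add: model_step_def model_def zero_prod_def)
  with d show ?thesis by (intro that[of "min (d / 2) 1"]) auto
qed

text \<open>
  The same step taken with \<open>R n\<close> in place of the model is uniformly close to \<open>model_step\<close>, because the
  derivatives in \<open>v\<close> converge by Cauchy's inequality. It therefore maps a small ball into itself, and a
  fixed point, which exists by Brouwer's theorem, solves the system. Since the model step halves
  norms, the fixed point is bounded by twice the distance between the two steps,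
  so it tends to 0.
\<close>

theorem double_points_near_model:
  fixes R :: "nat \<Rightarrow> complex \<Rightarrow> complex \<Rightarrow> complex"
  assumes cont: "\<forall>\<^sub>F n in sequentially. continuous_on (cball 0 2 \<times> cball 0 2) (\<lambda>(w, v). R n w v)"
    and hol: "\<forall>\<^sub>F n in sequentially. \<forall>w\<in>cball 0 2. R n w holomorphic_on UNIV"
    and lim: "uniform_limit (cball 0 2 \<times> cball 0 2) (\<lambda>n (w, v). R n w v) (\<lambda>(w, v). model w v) sequentially"
  obtains w v :: "nat \<Rightarrow> complex" where "w \<longlonglongrightarrow> 0" "v \<longlonglongrightarrow> 0" "\<And>n. norm (w n) \<le> 1"
    "\<forall>\<^sub>F n in sequentially. R n (w n) (v n) = 1 \<and> (R n (w n) has_field_derivative 0) (at (v n))"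
proof -
  obtain r where r: "0 < r" "r \<le> 1" "\<And>p. norm p \<le> r \<Longrightarrow> norm (model_step p) \<le> norm p / 2"
    using model_step_contracting by blast
  define step where "step = (\<lambda>n (w, v). (w - (R n w v - 1), v + deriv (R n w) v / 2))"
  have close: "\<forall>\<^sub>F n in sequentially. \<forall>p\<in>cball 0 1. norm (step n p - model_step p) \<le> e" if e: "e > 0" for e
  proof -
    have "\<forall>\<^sub>F n in sequentially. \<forall>p\<in>cball 0 2 \<times> cball 0 2. dist ((\<lambda>(w, v). R n w v) p) ((\<lambda>(w, v). model w v) p) < e / 2"
      using uniform_limitD[OF lim, of "e / 2"] e by simp
    with hol show ?thesis
    proof eventually_elim
      case (elim n)
      have R: "norm (R n w v - model w v) \<le> e / 2" if "norm w \<le> 2" "norm v \<le> 2" for w v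
        using elim(2)[rule_format, of "(w, v)"] that by (simp add: dist_norm)
      show ?case
      proof
        fix p :: "complex \<times> complex" assume p: "p \<in> cball 0 1"
        obtain w v where wv: "p = (w, v)" by (cases p)
        have w: "norm w \<le> 1" and v: "norm v \<le> 1"
          using p norm_fst_le[of w v] norm_snd_le[of v w] by (auto simp: wv)
        have mh: "model w holomorphic_on UNIV"
          unfolding model_def by (intro holomorphic_intros)
        have Rh: "R n w holomorphic_on UNIV" using elim(1) w by simp
        have "norm (deriv (\<lambda>v. R n w v - model w v) v) \<le> e / 2"
        proof (rule norm_deriv_le)
          show "(\<lambda>v. R n w v - model w v) holomorphic_on UNIV"
            by (intro holomorphic_intros mh Rh)
          fix z assume "norm (v - z) = 1"
          then have "norm z \<le> 2"
            using v norm_triangle_ineq4[of v "v - z"] by simp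
          then show "norm (R n w z - model w z) \<le> e / 2" using R w by simp
        qed
        also have "deriv (\<lambda>v. R n w v - model w v) v = deriv (R n w) v - deriv (model w) v"
          using mh Rh by (intro deriv_diff) (auto simp: holomorphic_on_imp_differentiable_at)
        finally have D: "norm (deriv (R n w) v - deriv (model w) v) \<le> e / 2" .
        have "step n p - model_step p = (- (R n w v - model w v), (deriv (R n w) v - deriv (model w) v) / 2)"
          by (simp add: step_def model_step_def wv deriv_model field_simps)
        also have "norm \<dots> \<le> norm (- (R n w v - model w v)) + norm ((deriv (R n w) v - deriv (model w) v) / 2)"
          by (rule norm_Pair_le)
        also have "\<dots> \<le> e / 2 + e / 4"
          using R[of w v] D w v by (intro add_mono) (auto simp: norm_minus_cancel norm_divide norm_minus_commute)
        finally show "norm (step n p - model_step p) \<le> e" using e by simp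
      qed
    qed
  qed
  have "\<forall>\<^sub>F n in sequentially. \<exists>p\<in>cball 0 r. step n p = p"
    using cont hol close[OF half_gt_zero[OF r(1)]]
  proof eventually_elim
    case (elim n)
    have "continuous_on (cball 0 1 \<times> cball 0 1) (\<lambda>(w, v). deriv (R n w) v)"
      using elim by (intro continuous_on_deriv_snd) auto
    moreover have "continuous_on (cball 0 1 \<times> cball 0 1) (\<lambda>(w, v). R n w v)"
      by (rule continuous_on_subset[OF elim(1)]) auto
    ultimately have "continuous_on (cball 0 1 \<times> cball 0 1) (step n)"
      unfolding step_def case_prod_unfold by (intro continuous_intros) auto
    moreover have "cball (0 :: complex \<times> complex) r \<subseteq> cball 0 1 \<times> cball 0 1"
    proof
      fix p :: "complex \<times> complex" assume "p \<in> cball 0 r"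
      then show "p \<in> cball 0 1 \<times> cball 0 1"
        using r(2) norm_fst_le[of "fst p" "snd p"] norm_snd_le[of "snd p" "fst p"] by (auto simp: mem_Times_iff)
    qed
    ultimately have c: "continuous_on (cball 0 r) (step n)"
      by (rule continuous_on_subset)
    have "step n p \<in> cball 0 r" if p: "p \<in> cball 0 r" for p
    proof -
      have "norm (step n p) \<le> norm (model_step p) + norm (step n p - model_step p)"
        using norm_triangle_ineq[of "model_step p" "step n p - model_step p"] by simp
      also have "\<dots> \<le> r / 2 + r / 2"
        using r(3)[of p] elim(3) p r(2) by (intro add_mono) (auto intro: order.trans)
      finally show ?thesis by simp
    qed
    then have im: "step n \<in> cball 0 r \<rightarrow> cball 0 r" by blast
    obtain p where "p \<in> cball 0 r" "step n p = p"
      by (rule brouwer[OF compact_cball convex_cball _ c im]) (use r(1) in auto)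
    then show ?case by blast
  qed
  then obtain n0 where "\<And>n. n \<ge> n0 \<Longrightarrow> \<exists>p\<in>cball 0 r. step n p = p"
    by (auto simp: eventually_sequentially)
  then obtain p where p: "\<And>n. n \<ge> n0 \<Longrightarrow> p n \<in> cball 0 r \<and> step n (p n) = p n"
    by metis
  define q where "q = (\<lambda>n. if n \<ge> n0 then p n else 0)"
  have q: "norm (q n) \<le> r" for n using p r(1) by (auto simp: q_def)
  have fixpt: "\<forall>\<^sub>F n in sequentially. step n (q n) = q n"
    using eventually_ge_at_top[of n0] by eventually_elim (use p in \<open>auto simp: q_def\<close>)
  have "q \<longlonglongrightarrow> 0"
  proof (rule tendstoI)
    fix e :: real assume e: "e > 0"
    have "\<forall>\<^sub>F n in sequentially. \<forall>p\<in>cball 0 1. norm (step n p - model_step p) \<le> e / 4"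
      using e by (intro close) simp
    with fixpt show "\<forall>\<^sub>F n in sequentially. dist (q n) 0 < e"
    proof eventually_elim
      case (elim n)
      have "norm (q n) \<le> norm (model_step (q n)) + norm (step n (q n) - model_step (q n))"
        using norm_triangle_ineq[of "model_step (q n)" "step n (q n) - model_step (q n)"] elim(1) by simp
      also have "\<dots> \<le> norm (q n) / 2 + e / 4"
        using r(3)[OF q] elim(2) q[of n] r(2) by (intro add_mono) (auto intro: order.trans)
      finally show ?case using e by simp
    qed
  qed
  then have "(\<lambda>n. fst (q n)) \<longlonglongrightarrow> 0" "(\<lambda>n. snd (q n)) \<longlonglongrightarrow> 0"
    by (auto dest: tendsto_fst tendsto_snd)
  moreover have bound: "norm (fst (q n)) \<le> 1" for n
    using q[of n] r(2) norm_fst_le[of "fst (q n)" "snd (q n)"] by simp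
  moreover have "\<forall>\<^sub>F n in sequentially. R n (fst (q n)) (snd (q n)) = 1
      \<and> (R n (fst (q n)) has_field_derivative 0) (at (snd (q n)))"
    using fixpt hol
  proof eventually_elim
    case (elim n)
    then have "R n (fst (q n)) (snd (q n)) = 1" "deriv (R n (fst (q n))) (snd (q n)) = 0"
      by (auto simp: step_def case_prod_unfold prod_eq_iff)
    moreover have "R n (fst (q n)) holomorphic_on UNIV"
      using elim(2) bound[of n] by auto
    ultimately show ?case using holomorphic_derivI[of "R n (fst (q n))" UNIV "snd (q n)"] by auto
  qed
  ultimately show ?thesis by (rule that)
qed

section \<open>The critical scaling\<close>

text \<open>
  The term \<open>- ln N / (2 N)\<close> balances the factor \<open>\<surd>N\<close> by which the theta series exceeds the tail
  at \<open>\<tau> = \<pi> / b\<close>. The constant \<open>\<kappa>\<close> is fixed at the end to absorb the remaining constants,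
  and \<open>w\<close> is the free parameter.
\<close>

definition crit_tau :: "nat \<Rightarrow> complex \<Rightarrow> nat \<Rightarrow> complex \<Rightarrow> complex" where
  "crit_tau b \<kappa> N w = of_real (pi / b) + (\<kappa> + w - of_real (ln N) / 2) / of_nat N"

definition crit_v :: "complex \<Rightarrow> complex" where
  "crit_v v = of_real (3 * pi / 4) + v"

text \<open>
  The second limit makes the quadratic error harmless when the exponent is expanded around
  \<open>\<tau> = \<pi> / b\<close> and multiplied by \<open>N\<close>.
\<close>

lemma crit_tau_tendsto:
  assumes N: "filterlim N at_top sequentially" and w: "w \<longlonglongrightarrow> w0"
  shows "(\<lambda>k. crit_tau b \<kappa> (N k) (w k)) \<longlonglongrightarrow> of_real (pi / b)"
    "(\<lambda>k. of_nat (N k) * (crit_tau b \<kappa> (N k) (w k) - of_real (pi / b))\<^sup>2) \<longlonglongrightarrow> 0"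
proof -
  have inv: "(\<lambda>k. 1 / complex_of_nat (N k)) \<longlonglongrightarrow> 0"
    using filterlim_compose[OF lim_1_over_n N] by simp
  have ln1: "(\<lambda>k. complex_of_real (ln (N k) / N k)) \<longlonglongrightarrow> of_real 0"
  proof (intro tendsto_of_real)
    have "(\<lambda>n. ln (real n) / real n) \<longlonglongrightarrow> 0" by real_asymp
    then show "(\<lambda>k. ln (N k) / N k) \<longlonglongrightarrow> 0" by (rule filterlim_compose[OF _ N])
  qed
  have ln2: "(\<lambda>k. complex_of_real ((ln (N k))\<^sup>2 / N k)) \<longlonglongrightarrow> of_real 0"
  proof (intro tendsto_of_real)
    have "(\<lambda>n. (ln (real n))\<^sup>2 / real n) \<longlonglongrightarrow> 0" by real_asymp
    then show "(\<lambda>k. (ln (N k))\<^sup>2 / N k) \<longlonglongrightarrow> 0" by (rule filterlim_compose[OF _ N])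
  qed
  have "(\<lambda>k. of_real (pi / b) + ((\<kappa> + w k) * (1 / of_nat (N k)) - complex_of_real (ln (N k) / N k) / 2))
      \<longlonglongrightarrow> of_real (pi / b) + ((\<kappa> + w0) * 0 - of_real 0 / 2)"
    by (intro tendsto_intros w inv ln1) auto
  then show "(\<lambda>k. crit_tau b \<kappa> (N k) (w k)) \<longlonglongrightarrow> of_real (pi / b)"
    by (simp add: crit_tau_def diff_divide_distrib add_divide_distrib mult.commute)
  have "(\<lambda>k. (\<kappa> + w k)\<^sup>2 * (1 / of_nat (N k)) - (\<kappa> + w k) * complex_of_real (ln (N k) / N k)
      + complex_of_real ((ln (N k))\<^sup>2 / N k) / 4) \<longlonglongrightarrow> (\<kappa> + w0)\<^sup>2 * 0 - (\<kappa> + w0) * of_real 0 + of_real 0 / 4"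
    by (intro tendsto_intros w inv ln1 ln2) auto
  moreover have "of_nat (N k) * (crit_tau b \<kappa> (N k) (w k) - of_real (pi / b))\<^sup>2 =
     (\<kappa> + w k)\<^sup>2 * (1 / of_nat (N k)) - (\<kappa> + w k) * complex_of_real (ln (N k) / N k)
      + complex_of_real ((ln (N k))\<^sup>2 / N k) / 4" for k
    by (cases "N k = 0") (simp_all add: crit_tau_def power2_eq_square field_simps)
  ultimately show "(\<lambda>k. of_nat (N k) * (crit_tau b \<kappa> (N k) (w k) - of_real (pi / b))\<^sup>2) \<longlonglongrightarrow> 0"
    by simp
qed

text \<open>
  The normalised theta series tends to \<open>exp \<kappa>\<close> times this constant times the model. The factor \<open>\<surd>2\<close> comes from \<open>sin (3 \<pi> / 4 + v) = (cos v - sin v) / \<surd>2\<close>.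
\<close>

definition model_const :: "nat \<Rightarrow> complex \<Rightarrow> complex" where
  "model_const b \<omega> = exp (of_real (pi / (2 * b) + 3 * pi / 4)) * of_real (sqrt (2 * pi) / sqrt (pi * b))
     * (2 * \<i> * twisted_gauss_sum \<omega> b) / of_real (sqrt 2)"

text \<open>
  After inversion the normalised theta series is a product of three factors: \<open>exp (X k)\<close>, the
  exponent that remains once the terms of order \<open>N\<close> cancel; \<open>g k\<close>, the Gaussian integral
  divided by \<open>\<surd>N\<close>; and \<open>S k\<close>, the sum over residues, which tends to a multiple of the sine.
\<close>

lemma theta_critical_limit:
  fixes \<kappa> :: complex and t u :: "nat \<Rightarrow> complex"
  assumes prim: "primitive_root_of_unity b \<omega>"
    and N: "filterlim N at_top sequentially" and w: "w \<longlonglongrightarrow> w0" and v: "v \<longlonglongrightarrow> v0"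
  defines "t \<equiv> \<lambda>k. crit_tau b \<kappa> (N k) (w k) / of_nat (N k)"
  defines "u \<equiv> \<lambda>k. crit_v (v k) / of_nat (N k)"
  shows "(\<lambda>k. exp (t k * (of_nat (N k) * (of_nat (N k) + 1)) / 2 + (of_nat (N k) + 1) * u k)
      * gauss_series (twist \<omega>) UNIV (t k) (u k - t k / 2))
    \<longlonglongrightarrow> exp \<kappa> * model_const b \<omega> * (exp (w0 + v0) * (cos v0 - sin v0))"
proof -
  have b: "b \<ge> 1" using prim by (auto simp: primitive_root_of_unity_def)
  define \<tau> where "\<tau> = (\<lambda>k. crit_tau b \<kappa> (N k) (w k))"
  define x where "x = (\<lambda>k. crit_v (v k))"
  define x0 where "x0 = crit_v v0"
  define \<tau>0 where "\<tau>0 = complex_of_real (pi / b)"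
  have \<tau>0: "\<tau>0 \<noteq> 0" using b by (simp add: \<tau>0_def)
  have \<tau>: "\<tau> \<longlonglongrightarrow> \<tau>0" and \<tau>2: "(\<lambda>k. of_nat (N k) * (\<tau> k - \<tau>0)\<^sup>2) \<longlonglongrightarrow> 0"
    using crit_tau_tendsto[OF N w] unfolding \<tau>_def \<tau>0_def by auto
  have x: "x \<longlonglongrightarrow> x0"
    unfolding x_def x0_def crit_v_def by (intro tendsto_intros v)
  have inv: "(\<lambda>k. 1 / complex_of_nat (N k)) \<longlonglongrightarrow> 0"
    using filterlim_compose[OF lim_1_over_n N] by simp
  have "(\<lambda>k. Re (\<tau> k)) \<longlonglongrightarrow> pi / b"
    using tendsto_Re[OF \<tau>] by (simp add: \<tau>0_def)
  then have "\<forall>\<^sub>F k in sequentially. 0 < Re (\<tau> k)"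
    using b by (intro order_tendstoD(1)) auto
  moreover have "\<forall>\<^sub>F k in sequentially. N k \<ge> 1"
    using N by (auto simp: filterlim_at_top)
  ultimately have ev: "\<forall>\<^sub>F k in sequentially. 0 < Re (\<tau> k) \<and> N k \<ge> 1"
    by eventually_elim simp
  define T where "T = (\<lambda>k. t k * (of_nat b)\<^sup>2)"
  have t_eq: "t k = \<tau> k / of_nat (N k)" and u_eq: "u k = x k / of_nat (N k)" for k
    by (simp_all add: t_def u_def \<tau>_def x_def)

  define X where "X = (\<lambda>k. (x k - \<tau> k / 2)\<^sup>2 / (2 * \<tau> k) * (1 / of_nat (N k)) + (\<kappa> + w k)
      - of_nat (N k) * (\<tau> k - \<tau>0)\<^sup>2 / (2 * \<tau> k) + \<tau> k / 2 + x k + x k * (1 / of_nat (N k)))"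
  have "X \<longlonglongrightarrow> (x0 - \<tau>0 / 2)\<^sup>2 / (2 * \<tau>0) * 0 + (\<kappa> + w0) - 0 / (2 * \<tau>0) + \<tau>0 / 2 + x0 + x0 * 0"
    unfolding X_def using \<tau>0 by (intro tendsto_intros x \<tau> \<tau>2 w inv) auto
  then have X: "X \<longlonglongrightarrow> \<kappa> + w0 + \<tau>0 / 2 + x0" by simp

  define g where "g = (\<lambda>k. gauss_integral (T k) / of_real (sqrt (N k)))"
  have g: "g \<longlonglongrightarrow> of_real (sqrt (2 * pi) / sqrt (pi * b))"
  proof -
    have "(\<lambda>k. \<tau> k / of_real (norm (\<tau> k))) \<longlonglongrightarrow> \<tau>0 / of_real (norm \<tau>0)"
      using \<tau>0 by (intro tendsto_intros \<tau>) auto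
    moreover have n\<tau>0: "norm \<tau>0 = pi / b"
      by (simp add: \<tau>0_def norm_divide)
    then have "of_real (norm \<tau>0) = \<tau>0" by (simp only: \<tau>0_def)
    then have "\<tau>0 / of_real (norm \<tau>0) = 1" using \<tau>0 by simp
    ultimately have "(\<lambda>k. gauss_integral (\<tau> k / of_real (norm (\<tau> k)))) \<longlonglongrightarrow> gauss_integral 1"
      by (intro gauss_integral_tendsto_1) simp
    then have "(\<lambda>k. gauss_integral (\<tau> k / of_real (norm (\<tau> k))) / of_real (sqrt (norm (\<tau> k)) * b)) \<longlonglongrightarrow>
       of_real (sqrt (2 * pi)) / of_real (sqrt (norm \<tau>0) * b)"
      using \<tau>0 b unfolding gauss_integral_1 by (intro tendsto_intros \<tau>) auto
    moreover have "sqrt (norm \<tau>0) * b = sqrt (pi * b)"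
      using b by (simp add: \<tau>0_def norm_divide real_sqrt_divide real_sqrt_mult field_simps)
    moreover have "\<forall>\<^sub>F k in sequentially. gauss_integral (\<tau> k / of_real (norm (\<tau> k))) / of_real (sqrt (norm (\<tau> k)) * b) = g k"
      using ev
    proof eventually_elim
      case (elim k)
      then have \<tau>k: "\<tau> k \<noteq> 0" by auto
      have T0: "T k \<noteq> 0" using elim \<tau>k b by (auto simp: T_def t_eq)
      have nT: "norm (T k) = norm (\<tau> k) * b\<^sup>2 / N k"
        by (simp add: T_def t_eq norm_mult norm_divide norm_power)
      have "T k / of_real (norm (T k)) = \<tau> k / of_real (norm (\<tau> k))"
        unfolding nT using elim \<tau>k b by (simp add: T_def t_eq)
      then have "gauss_integral (\<tau> k / of_real (norm (\<tau> k))) = of_real (sqrt (norm (T k))) * gauss_integral (T k)"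
        using gauss_integral_scale[OF T0] by simp
      moreover have "sqrt (norm (T k)) = sqrt (norm (\<tau> k)) * b / sqrt (N k)"
        by (simp add: nT real_sqrt_mult real_sqrt_divide)
      ultimately show ?case
        using elim \<tau>k b by (simp add: g_def)
    qed
    ultimately show ?thesis
      using Lim_transform_eventually by fastforce
  qed

  define y0 where "y0 = (x0 - \<tau>0 / 2) / (\<tau>0 * of_nat b)"
  define Y where "Y = (\<lambda>k r. (u k - t k / 2) / (t k * of_nat b) - of_nat r / of_nat b)"
  define p where "p = (\<lambda>k. 4 * pi\<^sup>2 / T k)"
  have Y: "(\<lambda>k. Y k r) \<longlonglongrightarrow> y0 - of_nat r / of_nat b" for r
  proof -
    have "(\<lambda>k. (x k - \<tau> k / 2) / (\<tau> k * of_nat b) - of_nat r / of_nat b) \<longlonglongrightarrow> y0 - of_nat r / of_nat b"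
      unfolding y0_def using \<tau>0 b by (intro tendsto_intros x \<tau>) auto
    moreover have "\<forall>\<^sub>F k in sequentially. (x k - \<tau> k / 2) / (\<tau> k * of_nat b) - of_nat r / of_nat b = Y k r"
      using ev
    proof eventually_elim
      case (elim k)
      then have "\<tau> k \<noteq> 0" by auto
      then show ?case using elim b by (simp add: Y_def t_eq u_eq field_simps)
    qed
    ultimately show ?thesis by (rule Lim_transform_eventually)
  qed
  have p: "filterlim (\<lambda>k. Re (p k)) at_top sequentially"
  proof -
    have "(\<lambda>k. Re (4 * pi\<^sup>2 / (\<tau> k * (of_nat b)\<^sup>2))) \<longlonglongrightarrow> Re (4 * pi\<^sup>2 / (\<tau>0 * (of_nat b)\<^sup>2))"
      using \<tau>0 b by (intro tendsto_intros \<tau>) auto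
    moreover have "Re (4 * pi\<^sup>2 / (\<tau>0 * (of_nat b)\<^sup>2)) = 4 * pi / b"
    proof -
      have "4 * pi\<^sup>2 / (\<tau>0 * (of_nat b)\<^sup>2) = of_real (4 * pi / b)"
        using b by (simp add: \<tau>0_def power2_eq_square field_simps)
      then show ?thesis by (simp only: Re_complex_of_real)
    qed
    moreover have "4 * pi / b > 0" using b by simp
    moreover have "filterlim (\<lambda>k. real (N k)) at_top sequentially"
      by (rule filterlim_compose[OF filterlim_real_sequentially N])
    ultimately have "filterlim (\<lambda>k. Re (4 * pi\<^sup>2 / (\<tau> k * (of_nat b)\<^sup>2)) * real (N k)) at_top sequentially"
      by (metis filterlim_tendsto_pos_mult_at_top)
    moreover have "Re (4 * pi\<^sup>2 / (\<tau> k * (of_nat b)\<^sup>2)) * real (N k) = Re (p k)" for k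
    proof -
      have "p k = of_real (real (N k)) * (4 * pi\<^sup>2 / (\<tau> k * (of_nat b)\<^sup>2))"
        by (simp add: p_def T_def t_eq)
      then show ?thesis by (simp only: times_complex.sel Re_complex_of_real Im_complex_of_real) simp
    qed
    ultimately show ?thesis by simp
  qed
  define S where "S = (\<lambda>k. \<Sum>r<b. twist \<omega> (int r) * exp (\<i> * pi * Y k r)
        * gauss_series (\<lambda>_. 1) UNIV (p k) (2 * pi * \<i> * Y k r - p k / 2))"
  have "S \<longlonglongrightarrow> (\<Sum>r<b. twist \<omega> (int r) * exp (\<i> * pi * (y0 - of_nat r / of_nat b))
        * (1 + exp (- (2 * pi * \<i> * (y0 - of_nat r / of_nat b)))))"
    unfolding S_def by (intro tendsto_intros gauss_series_two_leading_terms p Y)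
  also have "(\<Sum>r<b. twist \<omega> (int r) * exp (\<i> * pi * (y0 - of_nat r / of_nat b))
        * (1 + exp (- (2 * pi * \<i> * (y0 - of_nat r / of_nat b)))))
      = (\<Sum>r<b. exp (\<i> * x0) * (twist \<omega> (int r) * exp (- (\<i> * pi * (of_nat r + 1 / 2) / of_nat b)))
        + exp (- (\<i> * x0)) * (twist \<omega> (int r) * exp (\<i> * pi * (of_nat r + 1 / 2) / of_nat b)))"
  proof (intro sum.cong refl)
    fix r
    have arg: "\<i> * pi * (y0 - of_nat r / of_nat b) = \<i> * x0 + - (\<i> * pi * (of_nat r + 1 / 2) / of_nat b)"
      using b by (simp add: y0_def \<tau>0_def field_simps)
    have "exp (\<i> * pi * (y0 - of_nat r / of_nat b)) * (1 + exp (- (2 * pi * \<i> * (y0 - of_nat r / of_nat b))))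
       = exp (\<i> * pi * (y0 - of_nat r / of_nat b)) + exp (- (\<i> * pi * (y0 - of_nat r / of_nat b)))"
      by (simp add: ring_distribs flip: exp_add) (simp add: algebra_simps)
    also have "\<dots> = exp (\<i> * x0) * exp (- (\<i> * pi * (of_nat r + 1 / 2) / of_nat b))
       + exp (- (\<i> * x0)) * exp (\<i> * pi * (of_nat r + 1 / 2) / of_nat b)"
      unfolding arg exp_add[symmetric] by simp
    finally show "twist \<omega> (int r) * exp (\<i> * pi * (y0 - of_nat r / of_nat b))
        * (1 + exp (- (2 * pi * \<i> * (y0 - of_nat r / of_nat b))))
      = exp (\<i> * x0) * (twist \<omega> (int r) * exp (- (\<i> * pi * (of_nat r + 1 / 2) / of_nat b)))
        + exp (- (\<i> * x0)) * (twist \<omega> (int r) * exp (\<i> * pi * (of_nat r + 1 / 2) / of_nat b))"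
      by (simp only: mult.assoc) (simp only: ring_distribs mult.left_commute)
  qed
  also have "\<dots> = exp (\<i> * x0) * twisted_gauss_sum \<omega> b + exp (- (\<i> * x0)) * (- twisted_gauss_sum \<omega> b)"
    unfolding sum.distrib sum_distrib_left[symmetric] twisted_gauss_sum_reflect[OF prim]
    by (simp add: twisted_gauss_sum_def)
  also have "\<dots> = 2 * \<i> * twisted_gauss_sum \<omega> b * sin x0"
    by (simp add: sin_exp_eq field_simps)
  finally have S: "S \<longlonglongrightarrow> 2 * \<i> * twisted_gauss_sum \<omega> b * sin x0" .

  have "(\<lambda>k. exp (X k) * g k * S k) \<longlonglongrightarrow>
      exp (\<kappa> + w0 + \<tau>0 / 2 + x0) * of_real (sqrt (2 * pi) / sqrt (pi * b)) * (2 * \<i> * twisted_gauss_sum \<omega> b * sin x0)"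
    by (intro tendsto_intros X g S)
  also have "exp (\<kappa> + w0 + \<tau>0 / 2 + x0) * of_real (sqrt (2 * pi) / sqrt (pi * b)) * (2 * \<i> * twisted_gauss_sum \<omega> b * sin x0)
     = exp \<kappa> * model_const b \<omega> * (exp (w0 + v0) * (cos v0 - sin v0))"
  proof -
    have "sin x0 = (cos v0 - sin v0) / of_real (sqrt 2)"
    proof -
      have "sin (3 * pi / 4) = 1 / sqrt 2" "cos (3 * pi / 4) = - 1 / sqrt 2"
      proof -
        have "pi - pi / 4 = 3 * pi / 4" "sqrt 2 / 2 = 1 / sqrt 2" by (simp_all add: field_simps)
        then show "sin (3 * pi / 4) = 1 / sqrt 2" "cos (3 * pi / 4) = - 1 / sqrt 2"
          using sin_pi_minus[of "pi / 4"] cos_pi_minus[of "pi / 4"] by (simp_all add: sin_45 cos_45)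
      qed
      then have "sin (complex_of_real (3 * pi / 4)) = of_real (1 / sqrt 2)"
         "cos (complex_of_real (3 * pi / 4)) = of_real (- 1 / sqrt 2)"
        by (simp_all only: sin_of_real cos_of_real)
      then show ?thesis
        unfolding x0_def crit_v_def sin_add by (simp add: field_simps)
    qed
    moreover have "exp (\<kappa> + w0 + \<tau>0 / 2 + x0) = exp \<kappa> * exp (of_real (pi / (2 * b) + 3 * pi / 4)) * exp (w0 + v0)"
      unfolding exp_add[symmetric] by (intro arg_cong[of _ _ exp]) (simp add: \<tau>0_def x0_def crit_v_def)
    ultimately show ?thesis
      by (simp add: model_const_def)
  qed
  finally have "(\<lambda>k. exp (X k) * g k * S k) \<longlonglongrightarrow> exp \<kappa> * model_const b \<omega> * (exp (w0 + v0) * (cos v0 - sin v0))" .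
  moreover have "\<forall>\<^sub>F k in sequentially. exp (X k) * g k * S k =
      exp (t k * (of_nat (N k) * (of_nat (N k) + 1)) / 2 + (of_nat (N k) + 1) * u k)
      * gauss_series (twist \<omega>) UNIV (t k) (u k - t k / 2)"
    using ev
  proof eventually_elim
    case (elim k)
    then have \<tau>k: "\<tau> k \<noteq> 0" and Nk: "N k \<ge> 1" by auto
    have tpos: "Re (t k) > 0" using elim by (simp add: t_eq)
    let ?E = "t k * (of_nat (N k) * (of_nat (N k) + 1)) / 2 + (of_nat (N k) + 1) * u k"
    have S_eq: "S k = (\<Sum>r<b. twist \<omega> (int r) * exp (\<i> * pi * Y k r)
        * gauss_series (\<lambda>_. 1) UNIV (4 * pi\<^sup>2 / T k) (2 * pi * \<i> * Y k r - 2 * pi\<^sup>2 / T k))"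
      by (simp add: S_def p_def)
    have "gauss_series (twist \<omega>) UNIV (t k) (u k - t k / 2)
      = exp ((u k - t k / 2)\<^sup>2 / (2 * t k) - pi\<^sup>2 / (2 * T k)) * gauss_integral (T k) * S k"
      unfolding S_eq T_def Y_def by (rule twisted_theta_transformation[OF prim tpos])
    moreover have "exp ?E * exp ((u k - t k / 2)\<^sup>2 / (2 * t k) - pi\<^sup>2 / (2 * T k)) = exp (X k) / of_real (sqrt (N k))"
    proof -
      have "\<tau> k - \<tau>0 = (\<kappa> + w k - of_real (ln (N k)) / 2) / of_nat (N k)"
        by (simp add: \<tau>_def \<tau>0_def crit_tau_def)
      then have \<delta>: "of_nat (N k) * (\<tau> k - \<tau>0) = \<kappa> + w k - of_real (ln (N k)) / 2"
        using Nk by simp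
\<comment> \<open>With \<open>\<delta> = \<tau> - \<pi> / b\<close> one has
  \<open>N (\<tau> / 2 - \<pi>\<^sup>2 / (2 b\<^sup>2 \<tau>)) = N \<delta> - N \<delta>\<^sup>2 / (2 \<tau>)\<close>, so nothing of order \<open>N\<close> survives.\<close>
      have "?E + ((u k - t k / 2)\<^sup>2 / (2 * t k) - pi\<^sup>2 / (2 * T k))
        = X k - (\<kappa> + w k) + of_nat (N k) * (\<tau> k - \<tau>0)"
        using \<tau>k Nk b
        by (simp add: X_def T_def t_eq u_eq \<tau>0_def power2_eq_square field_simps)
      then have "exp ?E * exp ((u k - t k / 2)\<^sup>2 / (2 * t k) - pi\<^sup>2 / (2 * T k)) = exp (X k - of_real (ln (N k)) / 2)"
        unfolding \<delta> exp_add[symmetric] by simp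
      also have "\<dots> = exp (X k) / exp (of_real (ln (N k) / 2))"
        by (simp add: exp_diff)
      also have "exp (of_real (ln (N k) / 2)) = complex_of_real (sqrt (N k))"
      proof -
        have "exp (ln (real (N k)) / 2) = sqrt (N k)"
          using Nk by (simp add: ln_sqrt[symmetric])
        then show ?thesis by (simp only: exp_of_real)
      qed
      finally show ?thesis .
    qed
    ultimately show ?case
      by (simp add: g_def mult_ac)
  qed
  ultimately show ?thesis by (rule Lim_transform_eventually)
qed

text \<open>
  Along one residue class modulo \<open>2 b\<close> the coefficients of the normalised tail do not depend on
  \<open>N\<close>, and the claim is continuity of the series at \<open>t = 0\<close>.
\<close>

lemma tail_critical_limit:
  fixes \<kappa> :: complex and t u :: "nat \<Rightarrow> complex"
  assumes prim: "primitive_root_of_unity b \<omega>"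
    and N: "filterlim N at_top sequentially" and Na: "\<And>k. \<exists>m. N k = a + 2 * b * m"
    and w: "w \<longlonglongrightarrow> w0" and v: "v \<longlonglongrightarrow> v0"
  defines "t \<equiv> \<lambda>k. crit_tau b \<kappa> (N k) (w k) / of_nat (N k)"
  defines "u \<equiv> \<lambda>k. crit_v (v k) / of_nat (N k)"
  shows "(\<lambda>k. gauss_series (\<lambda>j. twist \<omega> (int (N k) + j)) {0..} (t k) (- u k - t k * of_nat (N k) - t k / 2))
    \<longlonglongrightarrow> tail_limit b \<omega> (int a)"
proof -
  have b: "b \<ge> 1" using prim by (auto simp: primitive_root_of_unity_def)
  define \<tau> where "\<tau> = (\<lambda>k. crit_tau b \<kappa> (N k) (w k))"
  have \<tau>: "\<tau> \<longlonglongrightarrow> of_real (pi / b)"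
    using crit_tau_tendsto[OF N w] unfolding \<tau>_def by auto
  have inv: "(\<lambda>k. 1 / complex_of_nat (N k)) \<longlonglongrightarrow> 0"
    using filterlim_compose[OF lim_1_over_n N] by simp
  have N1: "\<forall>\<^sub>F k in sequentially. N k \<ge> 1"
    using N by (auto simp: filterlim_at_top)
  have Nk: "(\<lambda>j. twist \<omega> (int (N k) + j)) = (\<lambda>j. twist \<omega> (int a + j))" for k
  proof
    fix j
    obtain m where "N k = a + 2 * b * m" using Na by blast
    then show "twist \<omega> (int (N k) + j) = twist \<omega> (int a + j)"
      using twist_periodic[OF prim, of "int a + j" "int m"] by (simp add: algebra_simps)
  qed
  have "(\<lambda>k. \<tau> k * (1 / of_nat (N k))) \<longlonglongrightarrow> of_real (pi / b) * 0"
    by (intro tendsto_intros \<tau> inv)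
  then have t: "t \<longlonglongrightarrow> 0" by (simp add: t_def \<tau>_def)
  define s where "s = (\<lambda>k. - u k - t k * of_nat (N k) - t k / 2)"
  have s: "s \<longlonglongrightarrow> - of_real (pi / b)"
  proof -
    have "(\<lambda>k. - (crit_v (v k) * (1 / of_nat (N k))) - \<tau> k - t k / 2) \<longlonglongrightarrow> - (crit_v v0 * 0) - of_real (pi / b) - 0 / 2"
      unfolding crit_v_def by (intro tendsto_intros \<tau> inv t v) auto
    moreover have "\<forall>\<^sub>F k in sequentially. - (crit_v (v k) * (1 / of_nat (N k))) - \<tau> k - t k / 2 = s k"
      using N1 by eventually_elim (simp add: s_def u_def t_def \<tau>_def)
    ultimately show ?thesis by (simp add: Lim_transform_eventually)
  qed
  have Re_\<tau>: "\<forall>\<^sub>F k in sequentially. 0 < Re (\<tau> k)"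
    using tendsto_Re[OF \<tau>] b by (intro order_tendstoD(1)[of _ "pi / b"]) auto
  have Re_s: "\<forall>\<^sub>F k in sequentially. Re (s k) < - (pi / (2 * b))"
    using tendsto_Re[OF s] b by (intro order_tendstoD(2)[of _ "- (pi / b)"]) (auto simp: field_simps)
  have cont: "continuous_on {(t, z). 0 \<le> Re t \<and> Re z \<le> - (pi / (2 * b))}
        (\<lambda>(t, z). gauss_series (\<lambda>j. twist \<omega> (int a + j)) {0..} t z)"
    by (rule continuous_on_gauss_series_right[of _ 1])
      (use b norm_twist[OF norm_root_of_unity[OF prim]] in auto)
  have lim: "(\<lambda>k. (t k, s k)) \<longlonglongrightarrow> (0, - of_real (pi / b))"
    by (intro tendsto_intros t s)
  have mem: "(0, - complex_of_real (pi / b)) \<in> {(t, z). 0 \<le> Re t \<and> Re z \<le> - (pi / (2 * b))}"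
    using b by (auto simp: field_simps)
  have "\<forall>\<^sub>F k in sequentially. (t k, s k) \<in> {(t, z). 0 \<le> Re t \<and> Re z \<le> - (pi / (2 * b))}"
    using Re_\<tau> Re_s by eventually_elim (auto simp: t_def \<tau>_def)
  from continuous_on_tendsto_compose[OF cont lim mem this]
  show ?thesis
    by (simp add: Nk tail_limit_def s_def)
qed

section \<open>From H to the partial theta function\<close>

lemma Theta_abs_summable:
  fixes q x :: complex
  assumes "norm q < 1"
  shows "summable (\<lambda>j. norm (q ^ (j * (j + 1) div 2) * x ^ j))"
proof -
  have "(\<lambda>n. norm q ^ Suc n * norm x) \<longlonglongrightarrow> 0 * norm x"
    using assms by (intro tendsto_mult tendsto_const LIMSEQ_Suc LIMSEQ_realpow_zero) auto
  then have "\<forall>\<^sub>F n in sequentially. norm q ^ Suc n * norm x < 1 / 2"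
    by (intro order_tendstoD(2)) auto
  then obtain n0 where n0: "\<And>n. n \<ge> n0 \<Longrightarrow> norm q ^ Suc n * norm x < 1 / 2"
    by (auto simp: eventually_sequentially)
  show ?thesis
  proof (rule summable_ratio_test[of "1 / 2" n0])
    fix n assume "n \<ge> n0"
    have "Suc n * (Suc n + 1) = n * (n + 1) + 2 * Suc n" by simp
    then have e: "Suc n * (Suc n + 1) div 2 = n * (n + 1) div 2 + Suc n" by simp
    have "q ^ (Suc n * (Suc n + 1) div 2) * x ^ Suc n = (q ^ Suc n * x) * (q ^ (n * (n + 1) div 2) * x ^ n)"
      unfolding e by (subst Power.power_add) (simp only: power_Suc mult_ac)
    then have "norm (q ^ (Suc n * (Suc n + 1) div 2) * x ^ Suc n) = (norm q ^ Suc n * norm x) * norm (q ^ (n * (n + 1) div 2) * x ^ n)"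
      by (simp only: norm_mult norm_power)
    also have "\<dots> \<le> 1 / 2 * norm (q ^ (n * (n + 1) div 2) * x ^ n)"
      using n0[OF \<open>n \<ge> n0\<close>] by (intro mult_right_mono) auto
    finally show "norm (norm (q ^ (Suc n * (Suc n + 1) div 2) * x ^ Suc n))
        \<le> 1 / 2 * norm (norm (q ^ (n * (n + 1) div 2) * x ^ n))" by simp
  qed simp
qed

lemma Theta_differentiable:
  assumes "norm q < 1"
  obtains D where "(Theta q has_field_derivative D) (at x)"
proof
  show "(Theta q has_field_derivative (\<Sum>n. diffs (\<lambda>j. q ^ (j * (j + 1) div 2)) n * x ^ n)) (at x)"
    unfolding Theta_def[abs_def]
    by (rule termdiffs_strong_converges_everywhere) (rule summable_norm_cancel[OF Theta_abs_summable[OF assms]])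
qed

text \<open>
  With \<open>x = - q\<^bsup>-N\<^esup> e\<^sup>z\<close> the substitution \<open>j = s + N\<close> gives
  \<open>j (j + 1) / 2 - N j = s (s + 1) / 2 - N (N - 1) / 2\<close>.
\<close>

lemma Theta_eq_H:
  assumes q: "norm q < 1" "q \<noteq> 0"
  shows "Theta q (- (q powi (- int N)) * exp z)
    = (- 1) ^ N * q powi (- (int N * (int N - 1) div 2)) * exp (of_nat N * z) * H N q z"
proof -
  let ?x = "- (q powi (- int N)) * exp z"
  let ?C = "(- 1) ^ N * q powi (- (int N * (int N - 1) div 2)) * exp (of_nat N * z)"
  define h where "h = (\<lambda>s::int. (-1) powi s * q ^ nat (s * (s + 1) div 2) * exp (of_int s * z))"
  have term_eq: "q ^ (j * (j + 1) div 2) * ?x ^ j = ?C * h (int j - int N)" for j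
  proof -
    define s where "s = int j - int N"
    have e: "int (j * (j + 1) div 2) - int N * int j = s * (s + 1) div 2 - int N * (int N - 1) div 2"
    proof -
      have "even (s * (s + 1))" "even (int N * (int N - 1))" "even (int j * (int j + 1))" by auto
      then have "2 * (s * (s + 1) div 2) = s * (s + 1)" "2 * (int N * (int N - 1) div 2) = int N * (int N - 1)"
          "2 * (int j * (int j + 1) div 2) = int j * (int j + 1)"
        by (metis dvd_mult_div_cancel)+
      moreover have "int (j * (j + 1) div 2) = int j * (int j + 1) div 2" by (simp add: zdiv_int ring_distribs)
      moreover have "int j * (int j + 1) - 2 * (int N * int j) = s * (s + 1) - int N * (int N - 1)"
        by (simp add: s_def algebra_simps)
      ultimately show ?thesis by linarith
    qed
    have s0: "s * (s + 1) div 2 \<ge> 0"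
      by (cases "s \<ge> 0") (auto simp: mult_nonpos_nonpos pos_imp_zdiv_nonneg_iff)
    have "q ^ (j * (j + 1) div 2) * (q powi (- int N)) ^ j = q powi (int (j * (j + 1) div 2) - int N * int j)"
      using q(2) by (simp add: power_int_diff power_int_minus power_int_mult power_int_of_nat field_simps)
    also have "\<dots> = q powi (- (int N * (int N - 1) div 2)) * q ^ nat (s * (s + 1) div 2)"
      unfolding e using q(2) s0 by (simp add: power_int_diff power_int_minus power_int_nonneg_exp field_simps)
    finally have 1: "q ^ (j * (j + 1) div 2) * (q powi (- int N)) ^ j = q powi (- (int N * (int N - 1) div 2)) * q ^ nat (s * (s + 1) div 2)" .
    have 2: "(- 1 :: complex) ^ j = (- 1) ^ N * (- 1) powi s"
      by (simp add: s_def power_int_diff flip: power_mult_distrib)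
    have 3: "exp z ^ j = exp (of_nat N * z) * exp (of_int s * z)"
      by (simp add: s_def algebra_simps flip: exp_of_nat_mult exp_add)
    have "?x ^ j = (- 1) ^ j * (q powi (- int N)) ^ j * exp z ^ j"
      by (simp add: power_mult_distrib power_minus[of "q powi (- int N) * exp z"])
    then have "q ^ (j * (j + 1) div 2) * ?x ^ j = (- 1) ^ j * (q ^ (j * (j + 1) div 2) * (q powi (- int N)) ^ j) * exp z ^ j"
      by (simp only: mult_ac)
    also have "\<dots> = ?C * h s"
      unfolding 1 2 3 h_def by (simp only: mult_ac)
    finally show ?thesis by (simp add: s_def)
  qed
  have "((\<lambda>j. q ^ (j * (j + 1) div 2) * ?x ^ j) has_sum Theta q ?x) UNIV"
    unfolding Theta_def
    by (intro norm_summable_imp_has_sum summable_sums summable_norm_cancel[OF Theta_abs_summable[OF q(1)]] Theta_abs_summable q)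
  then have "Theta q ?x = (\<Sum>\<^sub>\<infinity>j. ?C * h (int j - int N))"
    unfolding term_eq by (rule infsumI[symmetric])
  also have "\<dots> = ?C * (\<Sum>\<^sub>\<infinity>j. h (int j - int N))"
    by (rule infsum_cmult_right')
  also have "(\<Sum>\<^sub>\<infinity>j. h (int j - int N)) = infsum h {- int N..}"
    by (rule infsum_reindex_bij_betw, rule bij_betwI[where g = "\<lambda>s. nat (s + int N)"]) auto
  finally show ?thesis by (simp add: H_def h_def)
qed

text \<open>
  The substitution \<open>z \<mapsto> - q\<^bsup>-N\<^esup> e\<^sup>z\<close> has nonvanishing derivative, so a double zero of \<open>H\<close> in \<open>z\<close> is
  one of \<open>Theta q\<close>.
\<close>

lemma multiple_zero_Theta_of_H:
  assumes q: "norm q < 1" "q \<noteq> 0" and H0: "H N q u = 0" "(H N q has_field_derivative 0) (at u)"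
  shows "multiple_zero (Theta q) (- (q powi (- int N)) * exp u)"
proof -
  let ?x = "- (q powi (- int N)) * exp u"
  let ?C = "(- 1) ^ N * q powi (- (int N * (int N - 1) div 2))"
  obtain D where D: "(Theta q has_field_derivative D) (at ?x)"
    by (rule Theta_differentiable[OF q(1)])
  have "((\<lambda>z. Theta q (- (q powi (- int N)) * exp z)) has_field_derivative D * ?x) (at u)"
    by (rule DERIV_chain2[where f = "Theta q" and g = "\<lambda>z. - (q powi (- int N)) * exp z", OF D]) (auto intro!: derivative_eq_intros)
  moreover have "((\<lambda>z. ?C * exp (of_nat N * z) * H N q z) has_field_derivative 0) (at u)"
    by (rule derivative_eq_intros H0 refl)+ (simp add: H0)
  ultimately have "D * ?x = 0"
    unfolding Theta_eq_H[OF q] by (rule DERIV_unique)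
  then have "D = 0" using q(2) by simp
  moreover have "Theta q ?x = 0"
    using Theta_eq_H[OF q, of N u] H0 by simp
  ultimately show ?thesis
    using D by (simp add: multiple_zero_def)
qed

text \<open>
  Limits along the progression can be computed along its enumeration.
\<close>

lemma sequentially_within_arith_prog:
  assumes "d \<ge> 1"
  shows "sequentially_within (arith_prog a d) \<le> filtermap (\<lambda>n. a + n * d) sequentially"
proof (rule filter_leI)
  fix P assume "eventually P (filtermap (\<lambda>n. a + n * d) sequentially)"
  then obtain n0 where n0: "\<And>n. n \<ge> n0 \<Longrightarrow> P (a + n * d)"
    by (auto simp: eventually_filtermap eventually_sequentially)
  have "P N" if N: "N \<ge> a + n0 * d" and NS: "N \<in> arith_prog a d" for N
  proof -
    obtain n where n: "N = a + n * d" using NS by (auto simp: arith_prog_def)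
    then have "n0 \<le> n" using N assms by simp
    then show ?thesis using n0 n by simp
  qed
  then show "eventually P (sequentially_within (arith_prog a d))"
    unfolding sequentially_within_def eventually_inf_principal eventually_sequentially by blast
qed

lemma crit_tau_Re_pos:
  assumes "b \<ge> 1"
  shows "\<forall>\<^sub>F N in sequentially. \<forall>w\<in>cball 0 2. 0 < Re (crit_tau b \<kappa> N w)"
proof -
  have "(\<lambda>N. (norm \<kappa> + 2 + ln (real N) / 2) / real N) \<longlonglongrightarrow> 0" by real_asymp
  then have "\<forall>\<^sub>F N in sequentially. (norm \<kappa> + 2 + ln (real N) / 2) / real N < pi / b"
    using assms by (intro order_tendstoD(2)) auto
  then show ?thesis
  proof eventually_elim
    case (elim N)
    show ?case
    proof
      fix w :: complex assume "w \<in> cball 0 2"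
      then have "norm (\<kappa> + w) \<le> norm \<kappa> + 2"
        using norm_triangle_ineq[of \<kappa> w] by simp
      then have "- Re (\<kappa> + w) \<le> norm \<kappa> + 2"
        using abs_Re_le_cmod[of "\<kappa> + w"] by linarith
      then have "(- Re (\<kappa> + w) + ln (real N) / 2) / real N \<le> (norm \<kappa> + 2 + ln (real N) / 2) / real N"
        by (intro divide_right_mono) auto
      moreover have "Re (crit_tau b \<kappa> N w) = pi / b - (- Re (\<kappa> + w) + ln (real N) / 2) / real N"
        by (simp add: crit_tau_def Re_divide_of_nat diff_divide_distrib add_divide_distrib)
      ultimately show "0 < Re (crit_tau b \<kappa> N w)" using elim by simp
    qed
  qed
qed

lemma norm_crit_tau_le:
  assumes "norm w \<le> 1"
  shows "norm (crit_tau b \<kappa> N w - of_real (pi / b)) \<le> (norm \<kappa> + 1 + ln (real N)) / real N"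
proof -
  have "0 \<le> ln (real N)" by (cases "N = 0") auto
  then have "norm (\<kappa> + w - of_real (ln N) / 2) \<le> norm \<kappa> + 1 + ln (real N)"
    using norm_triangle_ineq4[of "\<kappa> + w" "of_real (ln N) / 2"] norm_triangle_ineq[of \<kappa> w] assms
    by (simp add: norm_divide)
  then have "norm (\<kappa> + w - of_real (ln N) / 2) / real N \<le> (norm \<kappa> + 1 + ln (real N)) / real N"
    by (rule divide_right_mono) simp
  then show ?thesis by (simp add: crit_tau_def norm_divide)
qed

text \<open>
  Since \<open>H\<close> is the theta series minus the tail and the normalised tail tends to \<open>- K\<close>, this is
  asymptotically the ratio of the theta series to the tail, but without a denominator that could vanish:
  it is entire in \<open>v\<close>, and \<open>H = 0\<close> is equivalent to the value being 1.
\<close>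

definition normalized_H :: "nat \<Rightarrow> complex \<Rightarrow> complex \<Rightarrow> complex \<Rightarrow> nat \<Rightarrow> complex \<Rightarrow> complex \<Rightarrow> complex" where
  "normalized_H b \<omega> \<kappa> K N w v = (let t = crit_tau b \<kappa> N w / of_nat N; u = crit_v v / of_nat N in
     1 - exp (t * (of_nat N * (of_nat N + 1)) / 2 + (of_nat N + 1) * u) * H N (\<omega> * exp (- t)) u / K)"

lemma normalized_H_tendsto:
  assumes prim: "primitive_root_of_unity b \<omega>"
    and N: "filterlim N at_top sequentially" and Na: "\<And>k. \<exists>m. N k = a + 2 * b * m"
    and w: "w \<longlonglongrightarrow> w0" and v: "v \<longlonglongrightarrow> v0"
    and K: "K = tail_limit b \<omega> (int a)" "K \<noteq> 0" and \<kappa>: "exp \<kappa> * model_const b \<omega> = - K"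
  shows "(\<lambda>k. normalized_H b \<omega> \<kappa> K (N k) (w k) (v k)) \<longlonglongrightarrow> model w0 v0"
proof -
  have b: "b \<ge> 1" using prim by (auto simp: primitive_root_of_unity_def)
  define t where "t = (\<lambda>k. crit_tau b \<kappa> (N k) (w k) / of_nat (N k))"
  define u where "u = (\<lambda>k. crit_v (v k) / of_nat (N k))"
  define E where "E = (\<lambda>k. exp (t k * (of_nat (N k) * (of_nat (N k) + 1)) / 2 + (of_nat (N k) + 1) * u k))"
  have "(\<lambda>k. E k * gauss_series (twist \<omega>) UNIV (t k) (u k - t k / 2)) \<longlonglongrightarrow>
      exp \<kappa> * model_const b \<omega> * (exp (w0 + v0) * (cos v0 - sin v0))"
    using theta_critical_limit[OF prim N w v, of \<kappa>] by (simp add: E_def t_def u_def)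
  moreover have "(\<lambda>k. gauss_series (\<lambda>j. twist \<omega> (int (N k) + j)) {0..} (t k) (- u k - t k * of_nat (N k) - t k / 2)) \<longlonglongrightarrow> K"
    using tail_critical_limit[OF prim N Na w v, of \<kappa>] by (simp add: t_def u_def K)
  ultimately have "(\<lambda>k. 1 - (E k * gauss_series (twist \<omega>) UNIV (t k) (u k - t k / 2)
     + gauss_series (\<lambda>j. twist \<omega> (int (N k) + j)) {0..} (t k) (- u k - t k * of_nat (N k) - t k / 2)) / K)
     \<longlonglongrightarrow> 1 - (exp \<kappa> * model_const b \<omega> * (exp (w0 + v0) * (cos v0 - sin v0)) + K) / K"
    by (intro tendsto_diff[OF tendsto_const] tendsto_divide[OF tendsto_add tendsto_const K(2)])
  also have "1 - (exp \<kappa> * model_const b \<omega> * (exp (w0 + v0) * (cos v0 - sin v0)) + K) / K = model w0 v0"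
    unfolding \<kappa> using K(2) by (simp add: model_def field_simps)
  finally have "(\<lambda>k. 1 - (E k * gauss_series (twist \<omega>) UNIV (t k) (u k - t k / 2)
     + gauss_series (\<lambda>j. twist \<omega> (int (N k) + j)) {0..} (t k) (- u k - t k * of_nat (N k) - t k / 2)) / K) \<longlonglongrightarrow> model w0 v0" .
  moreover have "\<forall>\<^sub>F k in sequentially. 1 - (E k * gauss_series (twist \<omega>) UNIV (t k) (u k - t k / 2)
     + gauss_series (\<lambda>j. twist \<omega> (int (N k) + j)) {0..} (t k) (- u k - t k * of_nat (N k) - t k / 2)) / K
     = normalized_H b \<omega> \<kappa> K (N k) (w k) (v k)"
  proof -
    have "\<forall>\<^sub>F k in sequentially. 0 < Re (crit_tau b \<kappa> (N k) (w k))"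
      using tendsto_Re[OF crit_tau_tendsto(1)[OF N w]] b by (intro order_tendstoD(1)[of _ "pi / b"]) auto
    moreover have "\<forall>\<^sub>F k in sequentially. N k \<ge> 1"
      using N by (auto simp: filterlim_at_top)
    ultimately show ?thesis
    proof eventually_elim
      case (elim k)
      then have "Re (t k) > 0" by (simp add: t_def)
      from H_eq_theta_minus_tail[OF prim this, of "N k" "u k"]
      show ?case
        by (simp add: normalized_H_def Let_def E_def t_def u_def)
    qed
  qed
  ultimately show ?thesis by (rule Lim_transform_eventually)
qed

lemma normalized_H_continuous:
  assumes prim: "primitive_root_of_unity b \<omega>" and N: "N \<ge> 1" and K: "K \<noteq> 0"
    and pos: "\<And>w. w \<in> A \<Longrightarrow> 0 < Re (crit_tau b \<kappa> N w)"
  shows "continuous_on (A \<times> B) (\<lambda>(w, v). normalized_H b \<omega> \<kappa> K N w v)"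
proof -
  have N0: "complex_of_nat N \<noteq> 0" using N by simp
  have c1: "continuous_on (A \<times> B) (\<lambda>p. crit_tau b \<kappa> N (fst p))"
    unfolding crit_tau_def using N by (intro continuous_intros) auto
  have c2: "continuous_on (A \<times> B) (\<lambda>p. crit_v (snd p))"
    unfolding crit_v_def by (intro continuous_intros)
  have "continuous_on (A \<times> B) (\<lambda>p. (\<lambda>(t, z). gauss_series (twist \<omega>) {- int N..} t z)
    (crit_tau b \<kappa> N (fst p) / of_nat N, crit_v (snd p) / of_nat N - crit_tau b \<kappa> N (fst p) / of_nat N / 2))"
    by (rule continuous_on_compose2[OF continuous_on_gauss_series[of _ 1]])
      (use N pos norm_twist[OF norm_root_of_unity[OF prim]] in \<open>auto intro!: continuous_intros c1 c2\<close>)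
  then show ?thesis
    unfolding normalized_H_def Let_def case_prod_unfold H_eq_gauss_series
    using N0 K by (intro continuous_intros c1 c2) auto
qed

lemma H_holomorphic:
  assumes prim: "primitive_root_of_unity b \<omega>" and "Re t > 0"
  shows "H N (\<omega> * exp (- t)) holomorphic_on UNIV"
proof -
  have "(\<lambda>u. gauss_series (twist \<omega>) {- int N..} t (u - t / 2)) holomorphic_on UNIV"
    by (rule holomorphic_on_compose_gen[OF _ gauss_series_holomorphic[of _ 1], unfolded o_def])
      (use assms(2) norm_twist[OF norm_root_of_unity[OF prim]] in \<open>auto intro!: holomorphic_intros\<close>)
  then show ?thesis by (simp add: H_eq_gauss_series[abs_def])
qed

lemma normalized_H_holomorphic:
  assumes prim: "primitive_root_of_unity b \<omega>" and N: "N \<ge> 1" and K: "K \<noteq> 0"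
    and pos: "0 < Re (crit_tau b \<kappa> N w)"
  shows "normalized_H b \<omega> \<kappa> K N w holomorphic_on UNIV"
proof -
  have "(\<lambda>v. H N (\<omega> * exp (- (crit_tau b \<kappa> N w / of_nat N))) (crit_v v / of_nat N)) holomorphic_on UNIV"
    by (rule holomorphic_on_compose_gen[OF _ H_holomorphic[OF prim], unfolded o_def])
      (use N pos in \<open>auto simp: crit_v_def intro!: holomorphic_intros\<close>)
  then show ?thesis
    unfolding normalized_H_def[abs_def] Let_def crit_v_def
    using N K by (intro holomorphic_intros) auto
qed

lemma double_zero_of_normalized_H:
  assumes N: "N \<ge> 1" and K: "K \<noteq> 0"
    and R: "normalized_H b \<omega> \<kappa> K N w v = 1" "(normalized_H b \<omega> \<kappa> K N w has_field_derivative 0) (at v)"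
  defines "q \<equiv> \<omega> * exp (- (crit_tau b \<kappa> N w / of_nat N))" and "u \<equiv> crit_v v / of_nat N"
  shows "H N q u = 0" "(H N q has_field_derivative 0) (at u)"
proof -
  have N0: "complex_of_nat N \<noteq> 0" using N by simp
  define A where "A = crit_tau b \<kappa> N w / of_nat N * (of_nat N * (of_nat N + 1)) / 2"
  define V where "V = (\<lambda>z::complex. of_nat N * z - of_real (3 * pi / 4))"
  have V: "crit_v (V z) / of_nat N = z" for z
    using N0 by (simp add: crit_v_def V_def)
  have Vu: "V u = v" using N0 by (simp add: u_def crit_v_def V_def)
  have H_eq: "H N q z = (1 - normalized_H b \<omega> \<kappa> K N w (V z)) * (K * exp (- (A + (of_nat N + 1) * z)))" for z
  proof -
    define X where "X = A + (of_nat N + 1) * z"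
    have "normalized_H b \<omega> \<kappa> K N w (V z) = 1 - exp X * H N q z / K"
      by (simp only: normalized_H_def Let_def V A_def q_def X_def)
    moreover have "exp X * exp (- X) = 1" by (rule exp_minus_inverse)
    ultimately show ?thesis using K by (simp add: X_def[symmetric] exp_minus)
  qed
  show "H N q u = 0" by (simp add: H_eq Vu R)
  have "((\<lambda>z. normalized_H b \<omega> \<kappa> K N w (V z)) has_field_derivative 0 * of_nat N) (at u)"
  proof (rule DERIV_chain2[where f = "normalized_H b \<omega> \<kappa> K N w" and g = V])
    show "(normalized_H b \<omega> \<kappa> K N w has_field_derivative 0) (at (V u))"
      using R(2) by (simp only: Vu)
    show "(V has_field_derivative of_nat N) (at u)"
      unfolding V_def by (auto intro!: derivative_eq_intros)
  qed
  then have "((\<lambda>z. normalized_H b \<omega> \<kappa> K N w (V z)) has_field_derivative 0) (at u)" by simp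
  from DERIV_diff[OF DERIV_const[of 1] this]
  have d1: "((\<lambda>z. 1 - normalized_H b \<omega> \<kappa> K N w (V z)) has_field_derivative 0) (at u)" by simp
  have d2: "((\<lambda>z. K * exp (- (A + (of_nat N + 1) * z))) has_field_derivative
      K * (exp (- (A + (of_nat N + 1) * u)) * (- (of_nat N + 1)))) (at u)"
    by (auto intro!: derivative_eq_intros)
  have "H N q = (\<lambda>z. (1 - normalized_H b \<omega> \<kappa> K N w (V z)) * (K * exp (- (A + (of_nat N + 1) * z))))"
    by (rule ext) (rule H_eq)
  with DERIV_mult[OF d1 d2] show "(H N q has_field_derivative 0) (at u)"
    by (simp add: Vu R)
qed

theorem theorem7p6:
  fixes \<omega> :: complex and b :: nat
  assumes "primitive_root_of_unity b \<omega>"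
  shows "\<exists>a d :: nat. a \<ge> 1 \<and> d \<ge> 1 \<and>
    (\<exists>\<tau> v :: nat \<Rightarrow> complex.
      let F = sequentially_within (arith_prog a d);
          q = (\<lambda>N. \<omega> * exp (- \<tau> N / of_nat N));
          u = (\<lambda>N. v N / of_nat N);
          x = (\<lambda>N. - (q N powi (- int N)) * exp (u N))
      in (\<lambda>N. norm (\<tau> N - of_real (pi / real b))) \<in> O[F](\<lambda>N. ln (real N) / real N) \<and>
         (v \<longlongrightarrow> of_real (3 * pi / 4)) F \<and>
         (q \<longlongrightarrow> \<omega>) F \<and>
         (\<forall>\<^sub>F N in F.
            norm (q N) < 1 \<and>
            q N \<in> Spec_Theta \<and>
            H N (q N) (u N) = 0 \<and>
            ((\<lambda>z. H N (q N) z) has_field_derivative 0) (at (u N)) \<and>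
            multiple_zero (Theta (q N)) (x N)))"
proof -
  note prim = assms
  have b: "b \<ge> 1" using prim by (auto simp: primitive_root_of_unity_def)
  have norm_\<omega>: "norm \<omega> = 1" by (rule norm_root_of_unity[OF prim])
  obtain a :: nat where a: "a \<ge> 1" "tail_limit b \<omega> (int a) \<noteq> 0"
    by (rule tail_limit_nonzero[OF prim])
  define K where "K = tail_limit b \<omega> (int a)"
  have K: "K \<noteq> 0" using a by (simp add: K_def)
  have mc: "model_const b \<omega> \<noteq> 0"
    using b twisted_gauss_sum_nonzero[OF prim] by (simp add: model_const_def)
\<comment> \<open>This choice puts the double point of the limit at the origin.\<close>
  define \<kappa> where "\<kappa> = Ln (- K / model_const b \<omega>)"
  have \<kappa>: "exp \<kappa> * model_const b \<omega> = - K"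
    using K mc by (simp add: \<kappa>_def exp_Ln)
  define d where "d = 2 * b"
  have d: "d \<ge> 1" using b by (simp add: d_def)
  define M where "M = (\<lambda>n. a + n * d)"
  have M1: "M n \<ge> 1" for n using a by (simp add: M_def)
  have Mlim: "filterlim M at_top sequentially"
    unfolding M_def using d by (intro filterlim_at_top_mono[OF filterlim_ident]) (auto intro!: always_eventually trans_le_add2)
  have Mmod: "\<exists>m. M n = a + 2 * b * m" for n
    by (intro exI[of _ n]) (simp add: M_def d_def)
  define R where "R = (\<lambda>n. normalized_H b \<omega> \<kappa> K (M n))"
  have pos: "\<forall>\<^sub>F n in sequentially. \<forall>w\<in>cball 0 2. 0 < Re (crit_tau b \<kappa> (M n) w)"
    using crit_tau_Re_pos[OF b] Mlim by (rule eventually_compose_filterlim)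
  have R_cont: "\<forall>\<^sub>F n in sequentially. continuous_on (cball 0 2 \<times> cball 0 2) (\<lambda>(w, v). R n w v)"
    using pos by eventually_elim (auto simp: R_def intro!: normalized_H_continuous[OF prim M1 K])
  have R_hol: "\<forall>\<^sub>F n in sequentially. \<forall>w\<in>cball 0 2. R n w holomorphic_on UNIV"
    using pos by eventually_elim (auto simp: R_def intro!: normalized_H_holomorphic[OF prim M1 K])
  have R_lim: "uniform_limit (cball 0 2 \<times> cball 0 2) (\<lambda>n (w, v). R n w v) (\<lambda>(w, v). model w v) sequentially"
    proof (rule uniform_limit_compactI)
      show "compact (cball (0::complex) 2 \<times> cball (0::complex) 2)"
        by (intro compact_Times compact_cball)
      show "continuous_on (cball 0 2 \<times> cball 0 2) (\<lambda>(w, v). model w v)"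
        unfolding model_def case_prod_unfold by (intro continuous_intros)
      fix \<phi> :: "nat \<Rightarrow> nat" and x :: "nat \<Rightarrow> complex \<times> complex" and l
      assume \<phi>: "strict_mono \<phi>" and x: "x \<longlonglongrightarrow> l"
      have "(\<lambda>n. normalized_H b \<omega> \<kappa> K (M (\<phi> n)) (fst (x n)) (snd (x n))) \<longlonglongrightarrow> model (fst l) (snd l)"
        by (rule normalized_H_tendsto[OF prim _ Mmod tendsto_fst[OF x] tendsto_snd[OF x] K_def K \<kappa>])
          (rule filterlim_compose[OF Mlim filterlim_subseq[OF \<phi>]])
      then show "(\<lambda>n. (\<lambda>(w, v). R (\<phi> n) w v) (x n)) \<longlonglongrightarrow> (\<lambda>(w, v). model w v) l"
        by (simp add: R_def case_prod_unfold)
  qed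
  obtain w v where wv: "w \<longlonglongrightarrow> 0" "v \<longlonglongrightarrow> 0" "\<And>n. norm (w n) \<le> 1"
    "\<forall>\<^sub>F n in sequentially. R n (w n) (v n) = 1 \<and> (R n (w n) has_field_derivative 0) (at (v n))"
    using double_points_near_model[OF R_cont R_hol R_lim] by blast
  define F where "F = sequentially_within (arith_prog a d)"
  have F_le: "F \<le> filtermap M sequentially"
    unfolding F_def M_def by (rule sequentially_within_arith_prog[OF d])
  have F_le': "F \<le> sequentially"
    by (simp add: F_def sequentially_within_def)
  define idx where "idx = (\<lambda>N. (N - a) div d)"
  have idx: "idx (M n) = n" for n using d by (simp add: idx_def M_def)
  define \<tau> where "\<tau> = (\<lambda>N. crit_tau b \<kappa> N (w (idx N)))"
  define V where "V = (\<lambda>N. crit_v (v (idx N)))"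
  define q where "q = (\<lambda>N. \<omega> * exp (- \<tau> N / of_nat N))"
  define u where "u = (\<lambda>N. V N / of_nat N)"
  have q_eq: "q (M n) = \<omega> * exp (- (crit_tau b \<kappa> (M n) (w n) / of_nat (M n)))" for n
    by (simp add: q_def \<tau>_def idx)
  have u_eq: "u (M n) = crit_v (v n) / of_nat (M n)" for n
    by (simp add: u_def V_def idx)
  have bigo: "(\<lambda>N. norm (\<tau> N - of_real (pi / real b))) \<in> O[F](\<lambda>N. ln (real N) / real N)"
  proof (rule bigoI)
    have "\<forall>\<^sub>F N in sequentially. norm (norm (\<tau> N - of_real (pi / real b))) \<le> (norm \<kappa> + 2) * norm (ln (real N) / real N)"
      using eventually_ge_at_top[of 3]
    proof eventually_elim
      case (elim N)
      have "exp 1 \<le> real N" using exp_le elim by linarith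
      then have ln1: "1 \<le> ln (real N)" using elim by (subst ln_ge_iff) auto
      then have "norm \<kappa> + 1 + ln (real N) \<le> (norm \<kappa> + 2) * ln (real N)"
        using mult_left_mono[OF ln1, of "norm \<kappa> + 1"] by (simp add: algebra_simps)
      then have "(norm \<kappa> + 1 + ln (real N)) / real N \<le> (norm \<kappa> + 2) * ln (real N) / real N"
        by (rule divide_right_mono) simp
      with norm_crit_tau_le[OF wv(3), of b \<kappa> N "idx N"] ln1 show ?case
        by (simp add: \<tau>_def)
    qed
    then show "\<forall>\<^sub>F N in F. norm (norm (\<tau> N - of_real (pi / real b))) \<le> (norm \<kappa> + 2) * norm (ln (real N) / real N)"
      by (rule filter_leD[OF F_le'])
  qed
  have v_lim: "(V \<longlongrightarrow> of_real (3 * pi / 4)) F"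
  proof (rule filterlim_mono[OF _ order_refl F_le])
    have "(\<lambda>n. of_real (3 * pi / 4) + v n) \<longlonglongrightarrow> of_real (3 * pi / 4) + 0"
      by (intro tendsto_intros wv)
    then show "(V \<longlongrightarrow> of_real (3 * pi / 4)) (filtermap M sequentially)"
      by (simp add: filterlim_filtermap V_def idx crit_v_def)
  qed
  have q_lim: "(q \<longlongrightarrow> \<omega>) F"
  proof (rule filterlim_mono[OF _ order_refl F_le])
    have inv: "(\<lambda>n. 1 / complex_of_nat (M n)) \<longlonglongrightarrow> 0"
      using filterlim_compose[OF lim_1_over_n Mlim] by simp
    have "(\<lambda>n. \<omega> * exp (- (crit_tau b \<kappa> (M n) (w n) * (1 / complex_of_nat (M n))))) \<longlonglongrightarrow>
      \<omega> * exp (- (of_real (pi / b) * 0))"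
      by (intro tendsto_intros inv crit_tau_tendsto(1)[OF Mlim wv(1)])
    then show "(q \<longlongrightarrow> \<omega>) (filtermap M sequentially)"
      by (simp add: filterlim_filtermap q_eq)
  qed
  have "\<forall>\<^sub>F n in sequentially. norm (q (M n)) < 1 \<and> H (M n) (q (M n)) (u (M n)) = 0
      \<and> (H (M n) (q (M n)) has_field_derivative 0) (at (u (M n)))"
    using pos wv(4)
  proof eventually_elim
    case (elim n)
    have "w n \<in> cball 0 2" using wv(3)[of n] by simp
    with elim(1) have "0 < Re (crit_tau b \<kappa> (M n) (w n))" by blast
    then have "norm (q (M n)) < 1"
      using M1[of n] by (simp add: q_eq norm_mult norm_\<omega>)
    moreover have "H (M n) (q (M n)) (u (M n)) = 0" "(H (M n) (q (M n)) has_field_derivative 0) (at (u (M n)))"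
      unfolding q_eq u_eq using elim(2) unfolding R_def
      by (auto intro!: double_zero_of_normalized_H[OF M1 K])
    ultimately show ?case by blast
  qed
  then have "\<forall>\<^sub>F N in filtermap M sequentially. norm (q N) < 1 \<and> H N (q N) (u N) = 0
      \<and> (H N (q N) has_field_derivative 0) (at (u N))"
    by (simp add: eventually_filtermap)
  then have "\<forall>\<^sub>F N in F. norm (q N) < 1 \<and> H N (q N) (u N) = 0
      \<and> (H N (q N) has_field_derivative 0) (at (u N))"
    by (rule filter_leD[OF F_le])
  then have main: "\<forall>\<^sub>F N in F. norm (q N) < 1 \<and> q N \<in> Spec_Theta \<and> H N (q N) (u N) = 0 \<and>
      ((\<lambda>z. H N (q N) z) has_field_derivative 0) (at (u N)) \<and>
      multiple_zero (Theta (q N)) (- (q N powi (- int N)) * exp (u N))"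
  proof eventually_elim
    case (elim N)
    have "q N \<noteq> 0" using norm_\<omega> by (auto simp: q_def)
    with elim have "multiple_zero (Theta (q N)) (- (q N powi (- int N)) * exp (u N))"
      by (intro multiple_zero_Theta_of_H) auto
    with elim show ?case by (auto simp: Spec_Theta_def)
  qed
  show ?thesis
    unfolding Let_def
    using a(1) d bigo v_lim q_lim main
    unfolding F_def q_def u_def by blast
qed

end
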